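(* Let $\mathbb{P}$ and $\mathbb{E}$ be the probability and expectation on the configuration space $\Omega$ over $\mathbb{X}$ making the configuration $\omega$ a Poisson random measure on $\mathbb{X}$ with control (intensity) measure $\sigma$. Let $n\ge 1$. For every $n$-process $f\ge 0$ and all $\epsilon=(\epsilon_1,\ldots,\epsilon_n)\in\{0,1\}^n$ we have $$\mathbb{E}\int_{\mathbb{X}^n} f(x;\omega)\,\omega_{\epsilon_1}(dx_1)\cdots\omega_{\epsilon_n}(dx_n)=\sum_{P=\{P_1,\ldots,P_k\}\in\mathcal{P}_n^{\epsilon}}\ \int_{\mathbb{X}^k_{\neq}}\mathbb{E}\, f\bigl(y^{[P]};\,\omega\cup y_{\epsilon^{[P]}}\bigr)\,\sigma^k(dy),$$ where $x=(x_1,\ldots,x_n)$, $y=(y_1,\ldots,y_k)$, and $k=k(P)$ is the number of blocks of $P$.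
   Context: $\mathbb{X}$ is a locally compact separable metric space. A configuration is a locally finite subset $\omega\subset\mathbb{X}$; $\Omega$ is the set of all configurations. A configuration $\omega=\{y_1,y_2,\ldots\}$ (distinct points) is identified with the measure $\sum_i\delta_{y_i}$. $\mathcal{F}$ is the smallest $\sigma$-algebra on $\Omega$ making $\omega\mapsto\omega(A)$ measurable for each Borel $A\subset\mathbb{X}$. $\sigma$ is a non-atomic Borel measure on $\mathbb{X}$, finite on compact sets. $\mathbb{P}$ is the probability on $(\Omega,\mathcal{F})$ under which $\omega$ is a Poisson random measure with intensity measure $\sigma$. An $n$-process is a jointly measurable map $f:\mathbb{X}^n\times\Omega\to[-\infty,\infty]$, $(x_1,\ldots,x_n;\omega)\mapsto f(x_1,\ldots,x_n;\omega)$. Notation: $\omega_1=\omega$ and $\omega_0=\sigma$. $\sigma^k(dy)=\sigma(dy_1)\cdots\sigma(dy_k)$. $\mathbb{X}^k_{\neq}$ is the set of $(y_1,\ldots,y_k)\in\mathbb{X}^k$ with pairwise distinct coordinates ($\mathbb{X}^1_{\neq}=\mathbb{X}$). $\mathcal{P}_n$ is the set of all partitions $P=\{P_1,\ldots,P_k\}$ of $\{1,\ldots,n\}$ into nonempty pairwise disjoint blocks (the enumeration of the blocks is arbitrary but fixed). For $\epsilon\in\{0,1\}^n$, $\mathcal{P}_n^{\epsilon}$ is the set of those $P\in\mathcal{P}_n$ such that for every block $P_i$ with $|P_i|>1$ one has $\epsilon_j=1$ for all $j\in P_i$. For $P=\{P_1,\ldots,P_k\}\in\mathcal{P}_n^{\epsilon}$,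 $\epsilon$ is constant on each block, and $\epsilon^{[P]}=(\epsilon^{[P]}_1,\ldots,\epsilon^{[P]}_k)$ is defined by $\epsilon^{[P]}_i=\epsilon_j$ for any $j\in P_i$. For $y=(y_1,\ldots,y_k)$, $y^{[P]}=(y^{[P]}_1,\ldots,y^{[P]}_n)\in\mathbb{X}^n$ is defined by $y^{[P]}_i=y_j$ if $i\in P_j$, and $y_{\epsilon^{[P]}}=\{y_i:\epsilon^{[P]}_i=1\}$. *)

theory Defs
  imports "HOL-Probability.Probability"
begin

definition locally_finite :: "'a::topological_space set \<Rightarrow> bool" where
  "locally_finite \<omega> \<longleftrightarrow> (\<forall>x. \<exists>U. open U \<and> x \<in> U \<and> finite (\<omega> \<inter> U))"

definition configurations :: "'a::topological_space set set" where
  "configurations = {\<omega>. locally_finite \<omega>}"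

(* The measure \<Sum>i. \<delta>(y i) of a configuration with distinct points y i, on the Borel
   \<sigma>-algebra: the image of the counting measure on \<omega> under the inclusion of \<omega>. *)
definition config_measure :: "'a::topological_space set \<Rightarrow> 'a measure" where
  "config_measure \<omega> = distr (count_space \<omega>) borel (\<lambda>y. y)"

lemma sets_config_measure [simp, measurable_cong]: "sets (config_measure \<omega>) = sets borel"
  by (simp add: config_measure_def)

lemma emeasure_config_measure:
  "A \<in> sets borel \<Longrightarrow> emeasure (config_measure \<omega>) A = emeasure (count_space \<omega>) (\<omega> \<inter> A)"
  by (simp add: config_measure_def emeasure_distr Int_commute)

(* The preimages below generate the smallest \<sigma>-algebra on the set of configurations for which
   all counting maps are measurable. The measure part of this object is irrelevant. *)
definition config_space :: "'a::topological_space set measure" where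
  "config_space = sigma configurations
     {{\<omega> \<in> configurations. emeasure (config_measure \<omega>) A \<in> B} | A B.
        A \<in> sets borel \<and> B \<in> sets borel}"

lemma space_config_space [simp]: "space config_space = configurations"
  by (simp add: config_space_def space_measure_of_conv)

definition atom_of :: "'a measure \<Rightarrow> 'a set \<Rightarrow> bool" where
  "atom_of \<sigma> A \<longleftrightarrow> A \<in> sets \<sigma> \<and> emeasure \<sigma> A > 0 \<and>
     (\<forall>B \<in> sets \<sigma>. B \<subseteq> A \<longrightarrow> emeasure \<sigma> B < emeasure \<sigma> A \<longrightarrow> emeasure \<sigma> B = 0)"

definition non_atomic :: "'a measure \<Rightarrow> bool" where
  "non_atomic \<sigma> \<longleftrightarrow> (\<nexists>A. atom_of \<sigma> A)"

(* The Poisson law is written out because poisson_pmf requires a positive rate; for rate 0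
   the formula gives the point mass at 0 (0 ^ 0 = 1). By the usual convention the Poisson law
   with infinite rate is the point mass at infinity. *)
definition poisson_random_measure :: "'a::topological_space measure \<Rightarrow> 'a set measure \<Rightarrow> bool" where
  "poisson_random_measure \<sigma> P \<longleftrightarrow>
     prob_space P \<and> sets P = sets config_space \<and>
     (\<forall>A \<in> sets borel. emeasure \<sigma> A < \<infinity> \<longrightarrow>
        (\<forall>k::nat. measure P {\<omega> \<in> space P. emeasure (config_measure \<omega>) A = of_nat k} =
           exp (- measure \<sigma> A) * measure \<sigma> A ^ k / fact k)) \<and>
     (\<forall>A \<in> sets borel. emeasure \<sigma> A = \<infinity> \<longrightarrow>
        (AE \<omega> in P. emeasure (config_measure \<omega>) A = \<infinity>)) \<and>
     (\<forall>(A :: nat \<Rightarrow> 'a set) m. (\<forall>i<m. A i \<in> sets borel) \<and> disjoint_family_on A {..<m} \<longrightarrow>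
        prob_space.indep_vars P (\<lambda>_. borel) (\<lambda>i \<omega>. emeasure (config_measure \<omega>) (A i)) {..<m})"

(* Points of the n-fold product are extensional functions on {1..n}. *)
definition n_process :: "nat \<Rightarrow> ((nat \<Rightarrow> 'a::topological_space) \<Rightarrow> 'a set \<Rightarrow> ereal) \<Rightarrow> bool" where
  "n_process n f \<longleftrightarrow>
     (\<lambda>(x, \<omega>). f x \<omega>) \<in> borel_measurable (PiM {1..n} (\<lambda>_. borel) \<Otimes>\<^sub>M config_space)"

(* The convention "\<omega> with index 1 is \<omega>, \<omega> with index 0 is \<sigma>". *)
definition choose_measure :: "'a::topological_space measure \<Rightarrow> 'a set \<Rightarrow> nat \<Rightarrow> 'a measure" where
  "choose_measure \<sigma> \<omega> e = (if e = 1 then config_measure \<omega> else \<sigma>)"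

definition distinct_tuples :: "nat \<Rightarrow> (nat \<Rightarrow> 'a) set" where
  "distinct_tuples k = {y \<in> {1..k} \<rightarrow>\<^sub>E UNIV. inj_on y {1..k}}"

definition eps_partitions :: "nat \<Rightarrow> (nat \<Rightarrow> nat) \<Rightarrow> nat set set set" where
  "eps_partitions n \<epsilon> =
     {P. partition_on {1..n} P \<and> (\<forall>p\<in>P. card p > 1 \<longrightarrow> (\<forall>j\<in>p. \<epsilon> j = 1))}"

(* In the next three definitions B 1, ..., B k enumerates the blocks of a partition. *)

definition block_eps :: "(nat \<Rightarrow> nat set) \<Rightarrow> (nat \<Rightarrow> nat) \<Rightarrow> nat \<Rightarrow> nat" where
  "block_eps B \<epsilon> i = \<epsilon> (SOME j. j \<in> B i)"

definition spread :: "nat \<Rightarrow> nat \<Rightarrow> (nat \<Rightarrow> nat set) \<Rightarrow> (nat \<Rightarrow> 'a) \<Rightarrow> (nat \<Rightarrow> 'a)" where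
  "spread n k B y = (\<lambda>i\<in>{1..n}. y (THE j. j \<in> {1..k} \<and> i \<in> B j))"

definition added_points :: "nat \<Rightarrow> (nat \<Rightarrow> nat set) \<Rightarrow> (nat \<Rightarrow> nat) \<Rightarrow> (nat \<Rightarrow> 'a) \<Rightarrow> 'a set" where
  "added_points k B \<epsilon> y = {y i | i. i \<in> {1..k} \<and> block_eps B \<epsilon> i = 1}"

end

theory Submission
  imports Defs "HOL-Library.Nat_Bijection"
begin

text \<open>
  The proof is an induction on the number of coordinates, driven by the Mecke formula: the expected
  sum of \<open>G x \<omega>\<close> over the points \<open>x\<close> of \<open>\<omega>\<close> is the integral of \<open>E (G x (\<omega> \<union> {x}))\<close> over
  \<open>\<sigma>(dx)\<close>. It is the case of a single coordinate. Integrate out the last coordinate first: the result is a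
  process in one coordinate less, and the induction hypothesis turns its expectation into a sum over
  partitions of integrals in which the configuration has been enlarged by one point for each marked
  block, that is, each block on which \<open>\<epsilon>\<close> equals one. If the last coordinate is integrated against \<open>\<sigma>\<close>, it becomes the variable of a new singleton
  block. If it is integrated against the enlarged configuration, it is either one of the points added
  before, so that the new coordinate joins the block of that point, or a point of the original
  configuration, and then the Mecke formula replaces it by the variable of a new marked block
  (\<open>mecke_union\<close>, \<open>retraction_moment_extend\<close>). This is how all admissible partitions of a larger set
  arise from those of the smaller one, each exactly once.

  The two alternatives for a point of the enlarged configuration are exclusive, and the points added
  for different blocks are different, up to null events, because \<open>\<sigma>\<close> does not charge points. For the
  same reason the integrals over tuples with distinct entries are integrals over the full product.

  The Mecke formula comes from the identity \<open>E (X h(X)) = l E h(X + 1)\<close> for a Poisson variable \<open>X\<close> with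
  rate \<open>l\<close> (\<open>poisson_shift\<close>). Independence of the counts over disjoint sets extends this to functions
  of finitely many counts (\<open>counts_shift\<close>, \<open>mecke_cylinder\<close>), and a monotone class argument to all
  measurable \<open>G\<close> (\<open>mecke\<close>). Since \<open>\<sigma>\<close> and the configurations are only locally finite, these
  arguments are carried out on the pieces of a countable partition into relatively compact Borel sets.

  In the induction a partition is represented by the map that sends each point to the least element of
  its block. The passage back to partitions with enumerated blocks is a change of summation index
  (\<open>bij_betw_fibres\<close>) and a renaming of integration variables (\<open>retraction_moment_eq_enumerated\<close>).
\<close>

section \<open>Configurations\<close>

lemma finite_configuration_Int_compact:
  assumes "\<omega> \<in> configurations" "compact K"
  shows "finite (\<omega> \<inter> K)"
proof -
  obtain U where U: "\<And>x. open (U x)" "\<And>x. x \<in> U x" "\<And>x. finite (\<omega> \<inter> U x)"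
    using assms(1) unfolding configurations_def locally_finite_def by simp metis
  then obtain T where T: "finite T" "K \<subseteq> (\<Union>x\<in>T. U x)"
    using compactE_image[OF assms(2), of UNIV U] by (metis UNIV_I UN_I subsetI)
  have "\<omega> \<inter> K \<subseteq> (\<Union>x\<in>T. \<omega> \<inter> U x)"
    using T by blast
  then show ?thesis
    by (rule finite_subset) (use T(1) U(3) in blast)
qed

lemma closed_configuration:
  fixes \<omega> :: "'a::t1_space set"
  assumes "\<omega> \<in> configurations"
  shows "closed \<omega>"
proof -
  have "\<exists>T. open T \<and> x \<in> T \<and> T \<subseteq> - \<omega>" if "x \<notin> \<omega>" for x
  proof -
    obtain U where U: "open U" "x \<in> U" "finite (\<omega> \<inter> U)"
      using assms unfolding configurations_def locally_finite_def by auto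
    have "open (U - \<omega> \<inter> U)"
      using U by (intro open_Diff finite_imp_closed)
    then show ?thesis
      using U that by (intro exI[of _ "U - \<omega> \<inter> U"]) auto
  qed
  then have "open (- \<omega>)"
    by (subst open_subopen) auto
  then show ?thesis
    by (simp add: closed_def)
qed

lemma configuration_insert:
  assumes "\<omega> \<in> configurations"
  shows "insert x \<omega> \<in> configurations"
  using assms unfolding configurations_def locally_finite_def by (simp add: Int_insert_left)

lemma nn_integral_config_measure:
  assumes "f \<in> borel_measurable borel"
  shows "(\<integral>\<^sup>+x. f x \<partial>config_measure \<omega>) = (\<integral>\<^sup>+x. f x \<partial>count_space \<omega>)"
  unfolding config_measure_def using assms by (subst nn_integral_distr) auto

lemma emeasure_config_measure_eq_0_iff:
  assumes "A \<in> sets borel"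
  shows "emeasure (config_measure \<omega>) A = 0 \<longleftrightarrow> \<omega> \<inter> A = {}"
  using assms by (simp add: emeasure_config_measure emeasure_count_space_eq_0)

lemma nn_integral_config_measure_union:
  fixes \<omega> :: "'a::topological_space set"
  assumes f: "f \<in> borel_measurable borel" and S: "finite S" "\<omega> \<inter> S = {}"
  shows "(\<integral>\<^sup>+x. f x \<partial>config_measure (\<omega> \<union> S)) = (\<integral>\<^sup>+x. f x \<partial>config_measure \<omega>) + (\<Sum>x\<in>S. f x)"
proof -
  have restrict: "(\<integral>\<^sup>+x. f x \<partial>count_space X) = (\<integral>\<^sup>+x. f x * indicator X x \<partial>count_space UNIV)" for X
    by (simp add: nn_integral_restrict_space[symmetric] restrict_count_space)
  have "(\<integral>\<^sup>+x. f x \<partial>count_space (\<omega> \<union> S)) =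
      (\<integral>\<^sup>+x. f x * indicator \<omega> x + f x * indicator S x \<partial>count_space UNIV)"
    unfolding restrict using S by (intro nn_integral_cong) (auto simp: indicator_def)
  also have "\<dots> = (\<integral>\<^sup>+x. f x \<partial>count_space \<omega>) + (\<integral>\<^sup>+x. f x \<partial>count_space S)"
    by (simp add: nn_integral_add restrict)
  finally show ?thesis
    using f S by (simp add: nn_integral_config_measure nn_integral_count_space_finite)
qed

lemma emeasure_config_measure_insert:
  assumes "A \<in> sets borel" "x \<notin> \<omega>"
  shows "emeasure (config_measure (insert x \<omega>)) A = emeasure (config_measure \<omega>) A + indicator A x"
  using nn_integral_config_measure_union[of "indicator A" "{x}" \<omega>] assms
  by (simp add: insert_commute)

section \<open>Measurability on the configuration space\<close>

lemma measurable_count_config [measurable]: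
  assumes "A \<in> sets borel"
  shows "(\<lambda>\<omega>. emeasure (config_measure \<omega>) A) \<in> borel_measurable config_space"
proof (rule measurableI)
  fix B :: "ennreal set" assume "B \<in> sets borel"
  then have "{\<omega> \<in> configurations. emeasure (config_measure \<omega>) A \<in> B} \<in> sets config_space"
    unfolding config_space_def using assms by (subst sets_measure_of) (auto intro!: sigma_sets.Basic)
  then show "(\<lambda>\<omega>. emeasure (config_measure \<omega>) A) -` B \<inter> space config_space \<in> sets config_space"
    by (simp add: vimage_def Int_def conj_commute)
qed simp

lemma measurable_into_config_space:
  fixes g :: "'b \<Rightarrow> 'a::topological_space set"
  assumes "\<And>w. w \<in> space N \<Longrightarrow> g w \<in> configurations"
    and "\<And>A. A \<in> sets borel \<Longrightarrow> (\<lambda>w. emeasure (config_measure (g w)) A) \<in> borel_measurable N"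
  shows "g \<in> measurable N config_space"
  unfolding config_space_def
proof (rule measurable_measure_of)
  fix y :: "'a set set" assume "y \<in> {{\<omega> \<in> configurations. emeasure (config_measure \<omega>) A \<in> B} | A B.
        A \<in> sets borel \<and> B \<in> sets borel}"
  then obtain A B where y: "y = {\<omega> \<in> configurations. emeasure (config_measure \<omega>) A \<in> B}"
    and AB: "A \<in> sets borel" "B \<in> sets borel" by blast
  have "g -` y \<inter> space N = (\<lambda>w. emeasure (config_measure (g w)) A) -` B \<inter> space N"
    using assms(1) by (auto simp: y)
  then show "g -` y \<inter> space N \<in> sets N"
    using measurable_sets[OF assms(2)[OF AB(1)] AB(2)] by simp
qed (use assms(1) in auto)

text \<open>A configuration is closed, so a point lies outside it exactly when some basic open set
  around the point is charged by no point of the configuration. This makes membership jointly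
  measurable.\<close>

lemma pred_member_config [measurable]:
  "Measurable.pred (borel \<Otimes>\<^sub>M config_space)
     (\<lambda>(x::'a::{second_countable_topology, t1_space}, \<omega>). x \<in> \<omega>)"
proof -
  obtain B :: "'a set set" where B: "countable B" "topological_basis B"
    using ex_countable_basis by blast
  have open_B: "open U" if "U \<in> B" for U
    using B(2) that topological_basis_open by blast
  have "Measurable.pred (borel \<Otimes>\<^sub>M config_space)
     (\<lambda>p. \<not> (\<exists>U\<in>B. fst p \<in> U \<and> emeasure (config_measure (snd p)) U = 0))"
  proof (intro pred_intros_logic measurable_pred_countable(2) B(1))
    fix U assume "U \<in> B"
    then have [measurable]: "U \<in> sets borel"
      using open_B by simp
    show "Measurable.pred (borel \<Otimes>\<^sub>M config_space) (\<lambda>p. fst p \<in> U)"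
      by measurable
    show "Measurable.pred (borel \<Otimes>\<^sub>M config_space)
        (\<lambda>p. emeasure (config_measure (snd p)) U = 0)"
      by measurable
  qed
  also have "?this \<longleftrightarrow> ?thesis"
  proof (rule measurable_cong)
    fix p :: "'a \<times> 'a set" assume p: "p \<in> space (borel \<Otimes>\<^sub>M config_space)"
    then have cl: "closed (snd p)"
      by (auto simp: space_pair_measure intro: closed_configuration)
    have "fst p \<notin> snd p \<longleftrightarrow> (\<exists>U\<in>B. fst p \<in> U \<and> snd p \<inter> U = {})"
    proof
      assume "fst p \<notin> snd p"
      moreover have "open (- snd p)"
        using cl by (simp add: closed_def)
      ultimately obtain U where "U \<in> B" "fst p \<in> U" "U \<subseteq> - snd p"
        using topological_basisE[OF B(2), of "- snd p" "fst p"] by blast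
      then show "\<exists>U\<in>B. fst p \<in> U \<and> snd p \<inter> U = {}"
        by blast
    qed blast
    moreover have "emeasure (config_measure (snd p)) U = 0 \<longleftrightarrow> snd p \<inter> U = {}" if "U \<in> B" for U
      using open_B[OF that] by (intro emeasure_config_measure_eq_0_iff) simp
    ultimately show "(\<not> (\<exists>U\<in>B. fst p \<in> U \<and> emeasure (config_measure (snd p)) U = 0)) =
        (case p of (x, \<omega>) \<Rightarrow> x \<in> \<omega>)"
      by (auto simp: case_prod_beta)
  qed
  finally show ?thesis .
qed

lemma measurable_insert_config:
  "(\<lambda>(x::'a::{second_countable_topology, t1_space}, \<omega>). insert x \<omega>)
     \<in> measurable (borel \<Otimes>\<^sub>M config_space) config_space"
proof (rule measurable_into_config_space)
  fix A :: "'a set" assume [measurable]: "A \<in> sets borel"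
  have "emeasure (config_measure (case w of (x, \<omega>) \<Rightarrow> insert x \<omega>)) A =
      emeasure (config_measure (snd w)) A +
      (if (case w of (x, \<omega>) \<Rightarrow> x \<in> \<omega>) then 0 else indicator A (fst w))" for w
    by (cases w) (auto simp: insert_absorb emeasure_config_measure_insert)
  moreover have "(\<lambda>w. emeasure (config_measure (snd w)) A +
      (if (case w of (x, \<omega>) \<Rightarrow> x \<in> \<omega>) then 0 else indicator A (fst w)))
      \<in> borel_measurable (borel \<Otimes>\<^sub>M config_space)"
    by measurable
  ultimately show "(\<lambda>w. emeasure (config_measure (case w of (x, \<omega>) \<Rightarrow> insert x \<omega>)) A)
      \<in> borel_measurable (borel \<Otimes>\<^sub>M config_space)"
    by simp
qed (auto simp: space_pair_measure configuration_insert)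

lemma measurable_insert_config' [measurable (raw)]:
  fixes g :: "'b \<Rightarrow> 'a::{second_countable_topology, t1_space}"
  assumes "g \<in> measurable N borel" "h \<in> measurable N config_space"
  shows "(\<lambda>w. insert (g w) (h w)) \<in> measurable N config_space"
  using measurable_compose[OF measurable_Pair[OF assms] measurable_insert_config] by simp

lemma measurable_union_config:
  fixes y :: "'b \<Rightarrow> 'i \<Rightarrow> 'a::{second_countable_topology, t1_space}"
  assumes "finite J" "\<And>j. j \<in> J \<Longrightarrow> (\<lambda>w. y w j) \<in> measurable N borel"
    and [measurable]: "h \<in> measurable N config_space"
  shows "(\<lambda>w. h w \<union> y w ` J) \<in> measurable N config_space"
  using assms(1,2)
proof (induction J rule: finite_induct)
  case (insert j J)
  then have [measurable]: "(\<lambda>w. y w j) \<in> measurable N borel"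
    "(\<lambda>w. h w \<union> y w ` J) \<in> measurable N config_space" by auto
  have "(\<lambda>w. insert (y w j) (h w \<union> y w ` J)) \<in> measurable N config_space"
    by measurable
  then show ?case
    by simp
qed simp

section \<open>Bounded Borel partitions\<close>

text \<open>Local compactness and the Lindelof property cut the space into countably many Borel sets
  which are relatively compact, hence carry finitely many points of every configuration and finite
  intensity. All finiteness arguments take place on one piece at a time.\<close>

lemma bounded_borel_partition:
  fixes \<sigma> :: "'a::{metric_space, second_countable_topology} measure"
  assumes lc: "locally_compact_space (euclidean :: 'a topology)"
    and sets: "sets \<sigma> = sets borel"
    and fin: "\<And>K. compact K \<Longrightarrow> emeasure \<sigma> K < \<infinity>"
  obtains D :: "nat \<Rightarrow> 'a set" where "\<And>m. D m \<in> sets borel" "disjoint_family D" "(\<Union>m. D m) = UNIV"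
    "\<And>m. emeasure \<sigma> (D m) < \<infinity>" "\<And>m \<omega>. \<omega> \<in> configurations \<Longrightarrow> finite (\<omega> \<inter> D m)"
proof -
  define F where "F = {U :: 'a set. open U \<and> (\<exists>K. compact K \<and> U \<subseteq> K)}"
  have "\<Union>F = UNIV"
    using lc unfolding locally_compact_space_def F_def by simp blast
  moreover obtain F' where "F' \<subseteq> F" "countable F'" "\<Union>F' = \<Union>F"
    by (rule Lindelof[of F]) (auto simp: F_def)
  ultimately have F': "F' \<subseteq> F" "countable F'" "\<Union>F' = UNIV"
    by simp_all
  define U where "U = from_nat_into F'"
  have "F' \<noteq> {}"
    using F'(3) by auto
  then have U: "range U = F'"
    unfolding U_def using F'(2) by (rule range_from_nat_into)
  have UF: "\<exists>K. compact K \<and> disjointed U m \<subseteq> K" for m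
  proof -
    have "U m \<in> F"
      using U F'(1) by blast
    then show ?thesis
      unfolding F_def using disjointed_subset[of U m] by (auto intro: order_trans)
  qed
  have "open (U m)" for m
  proof -
    have "U m \<in> F"
      using U F'(1) by blast
    then show ?thesis
      unfolding F_def by auto
  qed
  then have borel_U: "range U \<subseteq> sets borel"
    by auto
  show ?thesis
  proof
    show "disjointed U m \<in> sets borel" for m
      using sets.range_disjointed_sets[OF borel_U] by blast
    show "(\<Union>m. disjointed U m) = UNIV"
      using U F'(3) by (simp add: UN_disjointed_eq)
    show "emeasure \<sigma> (disjointed U m) < \<infinity>" for m
    proof -
      obtain K where K: "compact K" "disjointed U m \<subseteq> K"
        using UF by blast
      then have "emeasure \<sigma> (disjointed U m) \<le> emeasure \<sigma> K"
        by (intro emeasure_mono) (auto simp: sets compact_imp_closed)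
      then show ?thesis
        using fin[OF K(1)] by (rule le_less_trans)
    qed
    show "finite (\<omega> \<inter> disjointed U m)" if "\<omega> \<in> configurations" for m \<omega>
      using UF[of m] finite_configuration_Int_compact[OF that] by (meson finite_subset inf_mono order_refl)
  qed (rule disjoint_family_disjointed)
qed

lemma nn_integral_split_partition:
  fixes D :: "nat \<Rightarrow> 'a set"
  assumes D: "\<And>m. D m \<in> sets M" "disjoint_family D" "(\<Union>m. D m) = space M"
    and f: "f \<in> borel_measurable M"
  shows "(\<integral>\<^sup>+x. f x \<partial>M) = (\<Sum>m. \<integral>\<^sup>+x\<in>D m. f x \<partial>M)"
proof -
  have "(\<integral>\<^sup>+x. f x \<partial>M) = (\<integral>\<^sup>+x\<in>space M. f x \<partial>M)"
    by (intro nn_integral_cong) auto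
  also have "\<dots> = (\<integral>\<^sup>+x\<in>(\<Union>m. D m). f x \<partial>M)"
    by (simp add: D(3))
  also have "\<dots> = (\<Sum>m. \<integral>\<^sup>+x\<in>D m. f x \<partial>M)"
    using D f by (intro nn_integral_disjoint_family) auto
  finally show ?thesis .
qed

section \<open>Integration against a configuration\<close>

lemma ennreal_self_divide_le_1: "(a::ennreal) / a \<le> 1"
  by (cases "a = 0 \<or> a = top") (auto simp: ennreal_divide_self less_top)

locale bounded_partition =
  fixes D :: "nat \<Rightarrow> 'a::{metric_space, second_countable_topology} set"
  assumes borel_D [measurable]: "D m \<in> sets borel"
    and disjoint_D: "disjoint_family D"
    and UN_D: "(\<Union>m. D m) = UNIV"
    and finite_D: "\<omega> \<in> configurations \<Longrightarrow> finite (\<omega> \<inter> D m)"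
begin

lemma emeasure_config_D_finite: "\<omega> \<in> configurations \<Longrightarrow> emeasure (config_measure \<omega>) (D m) \<noteq> \<infinity>"
  using finite_D[of \<omega> m] by (simp add: emeasure_config_measure)

lemma sigma_finite_config_measure:
  fixes \<omega> :: "'a set"
  assumes "\<omega> \<in> configurations"
  shows "sigma_finite_measure (config_measure \<omega>)"
proof
  show "\<exists>A. countable A \<and> A \<subseteq> sets (config_measure \<omega>) \<and> \<Union>A = space (config_measure \<omega>) \<and>
      (\<forall>a\<in>A. emeasure (config_measure \<omega>) a \<noteq> \<infinity>)"
    using UN_D emeasure_config_D_finite[OF assms]
    by (intro exI[of _ "range D"]) (auto simp: config_measure_def)
qed

lemma nn_integral_config_split:
  assumes "f \<in> borel_measurable borel"
  shows "(\<integral>\<^sup>+x. f x \<partial>config_measure \<omega>) = (\<Sum>m. \<integral>\<^sup>+x\<in>D m. f x \<partial>config_measure \<omega>)"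
  using assms disjoint_D UN_D
  by (intro nn_integral_split_partition) (auto simp: config_measure_def)

text \<open>Restricted to one piece and normalised by its mass, the configuration becomes a
  sub-probability kernel, for which joint measurability of integrals is known. The integral against
  the whole configuration is a countable sum of these, weighted by the masses.\<close>

lemma measurable_nn_integral_config:
  fixes F :: "'b \<Rightarrow> 'a \<Rightarrow> ennreal" and h :: "'b \<Rightarrow> 'a set"
  assumes F: "case_prod F \<in> borel_measurable (N \<Otimes>\<^sub>M borel)" and h: "h \<in> measurable N config_space"
  shows "(\<lambda>w. \<integral>\<^sup>+x. F w x \<partial>config_measure (h w)) \<in> borel_measurable N"
proof -
  define c where "c m w = emeasure (config_measure (h w)) (D m)" for m w
  define \<kappa> where "\<kappa> m w = density (config_measure (h w)) (\<lambda>x. indicator (D m) x / c m w)" for m w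
  have conf: "h w \<in> configurations" if "w \<in> space N" for w
    using measurable_space[OF h that] by simp
  have meas_F: "F w \<in> borel_measurable borel" if "w \<in> space N" for w
    using measurable_Pair2[OF F that] by simp
  have meas_cm: "f \<in> borel_measurable (config_measure \<omega>) \<longleftrightarrow> f \<in> borel_measurable borel"
    for f :: "'a \<Rightarrow> ennreal" and \<omega>
    by (rule arg_cong2[where f="(\<in>)"]) (auto intro!: measurable_cong_sets)
  have [measurable]: "c m \<in> borel_measurable N" for m
    unfolding c_def using h by measurable
  have integral_\<kappa>: "(\<integral>\<^sup>+x. f x \<partial>\<kappa> m w) = (\<integral>\<^sup>+x\<in>D m. f x \<partial>config_measure (h w)) / c m w"
    if "f \<in> borel_measurable borel" for f m w
  proof -
    have [measurable]: "f \<in> borel_measurable (config_measure (h w))"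
      using that by (simp add: meas_cm)
    have "(\<integral>\<^sup>+x. f x \<partial>\<kappa> m w) = (\<integral>\<^sup>+x. (f x * indicator (D m) x) / c m w \<partial>config_measure (h w))"
      unfolding \<kappa>_def
      by (subst nn_integral_density) (auto intro!: nn_integral_cong simp: divide_ennreal_def ac_simps)
    also have "\<dots> = (\<integral>\<^sup>+x\<in>D m. f x \<partial>config_measure (h w)) / c m w"
      by (rule nn_integral_divide) simp
    finally show ?thesis .
  qed
  have emeasure_\<kappa>: "emeasure (\<kappa> m w) A = emeasure (config_measure (h w)) (D m \<inter> A) / c m w"
    if [measurable]: "A \<in> sets borel" for A m w
  proof -
    have "emeasure (\<kappa> m w) A = (\<integral>\<^sup>+x. indicator A x \<partial>\<kappa> m w)"
      using that by (simp add: \<kappa>_def)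
    also have "\<dots> = (\<integral>\<^sup>+x\<in>D m. indicator A x \<partial>config_measure (h w)) / c m w"
      by (intro integral_\<kappa>) simp
    also have "(\<integral>\<^sup>+x\<in>D m. indicator A x \<partial>config_measure (h w)) =
        (\<integral>\<^sup>+x. indicator (D m \<inter> A) x \<partial>config_measure (h w))"
      by (intro nn_integral_cong) (auto simp: indicator_def)
    finally show ?thesis
      using that by (subst (asm) nn_integral_indicator) auto
  qed
  have \<kappa>: "\<kappa> m \<in> measurable N (subprob_algebra borel)" for m
  proof (rule measurable_subprob_algebra)
    fix w assume w: "w \<in> space N"
    show "subprob_space (\<kappa> m w)"
    proof (rule subprob_spaceI)
      have "emeasure (\<kappa> m w) UNIV \<le> 1"
        using ennreal_self_divide_le_1 by (simp add: emeasure_\<kappa> c_def)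
      then show "emeasure (\<kappa> m w) (space (\<kappa> m w)) \<le> 1"
        by (simp add: \<kappa>_def config_measure_def)
    qed (simp add: \<kappa>_def config_measure_def)
    show "sets (\<kappa> m w) = sets borel"
      by (simp add: \<kappa>_def)
  next
    fix A :: "'a set" assume A [measurable]: "A \<in> sets borel"
    show "(\<lambda>w. emeasure (\<kappa> m w) A) \<in> borel_measurable N"
      unfolding emeasure_\<kappa>[OF A] using h by measurable
  qed
  have "(\<integral>\<^sup>+x. F w x \<partial>config_measure (h w)) = (\<Sum>m. c m w * (\<integral>\<^sup>+x. F w x \<partial>\<kappa> m w))"
    if w: "w \<in> space N" for w
  proof -
    have "c m w * (\<integral>\<^sup>+x. F w x \<partial>\<kappa> m w) = (\<integral>\<^sup>+x\<in>D m. F w x \<partial>config_measure (h w))" for m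
    proof (cases "c m w = 0")
      case True
      then have "AE x in config_measure (h w). x \<notin> D m"
        by (intro AE_not_in) (auto simp: c_def null_sets_def)
      then have "(\<integral>\<^sup>+x\<in>D m. F w x \<partial>config_measure (h w)) = (\<integral>\<^sup>+x. 0 \<partial>config_measure (h w))"
        by (intro nn_integral_cong_AE) (auto elim!: eventually_mono simp: indicator_def)
      with True show ?thesis by simp
    next
      case False
      moreover have "c m w \<noteq> \<infinity>"
        unfolding c_def by (intro emeasure_config_D_finite conf w)
      ultimately show ?thesis
        by (simp add: integral_\<kappa>[OF meas_F[OF w]] ennreal_times_divide mult_divide_eq_ennreal
            mult.commute[of "c m w"])
    qed
    then show ?thesis
      by (simp add: nn_integral_config_split[OF meas_F[OF w]])
  qed
  moreover have "(\<lambda>w. \<Sum>m. c m w * (\<integral>\<^sup>+x. F w x \<partial>\<kappa> m w)) \<in> borel_measurable N"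
    using nn_integral_measurable_subprob_algebra2[OF F \<kappa>] by measurable
  ultimately show ?thesis
    by (subst measurable_cong) auto
qed

end

section \<open>Shifting Poisson counts\<close>

text \<open>If \<open>X\<close> has the Poisson law with rate \<open>l\<close>, then \<open>k P(X = k) = l P(X = k - 1)\<close>; summing this
  against \<open>h k\<close> gives the identity. It is the one-dimensional case of the Mecke formula.\<close>

lemma (in prob_space) poisson_shift:
  fixes X :: "'a \<Rightarrow> ennreal"
  assumes X [measurable]: "X \<in> borel_measurable M"
    and law: "\<And>k::nat. prob {\<omega> \<in> space M. X \<omega> = of_nat k} = exp (- l) * l ^ k / fact k"
    and h [measurable]: "h \<in> borel_measurable borel" and l: "l \<ge> 0"
  shows "(\<integral>\<^sup>+\<omega>. X \<omega> * h (X \<omega>) \<partial>M) = ennreal l * (\<integral>\<^sup>+\<omega>. h (X \<omega> + 1) \<partial>M)"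
proof -
  define p where "p k = exp (- l) * l ^ k / fact k" for k :: nat
  define S where "S k = {\<omega> \<in> space M. X \<omega> = of_nat k}" for k :: nat
  have [measurable]: "S k \<in> sets M" for k
    unfolding S_def by measurable
  have disj: "disjoint_family S"
    by (auto simp: disjoint_family_on_def S_def)
  have "(\<lambda>k. l ^ k /\<^sub>R fact k) sums exp l"
    by (rule exp_converges)
  then have "p sums (exp (- l) * exp l)"
    unfolding p_def by (auto dest: sums_mult[where c="exp (- l)"] simp: divide_inverse ac_simps)
  then have "p sums 1"
    by (simp flip: exp_add)
  moreover have "p sums prob (\<Union>k. S k)"
  proof -
    have "(\<lambda>k. prob (S k)) sums prob (\<Union>k. S k)"
      using disj by (intro finite_measure_UNION) auto
    then show ?thesis
      using law unfolding S_def p_def by simp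
  qed
  ultimately have "prob (\<Union>k. S k) = 1"
    by (simp add: sums_iff)
  then have AE_S: "AE \<omega> in M. \<omega> \<in> (\<Union>k. S k)"
    by (intro AE_prob_1) auto
  have expand: "(\<integral>\<^sup>+\<omega>. g (X \<omega>) \<partial>M) = (\<Sum>k. g (of_nat k) * ennreal (p k))"
    if [measurable]: "g \<in> borel_measurable borel" for g :: "ennreal \<Rightarrow> ennreal"
  proof -
    have "(\<integral>\<^sup>+\<omega>. g (X \<omega>) \<partial>M) = (\<integral>\<^sup>+\<omega>\<in>(\<Union>k. S k). g (X \<omega>) \<partial>M)"
      using AE_S by (intro nn_integral_cong_AE) auto
    also have "\<dots> = (\<Sum>k. \<integral>\<^sup>+\<omega>\<in>S k. g (X \<omega>) \<partial>M)"
      using disj by (intro nn_integral_disjoint_family) auto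
    also have "\<dots> = (\<Sum>k. \<integral>\<^sup>+\<omega>. g (of_nat k) * indicator (S k) \<omega> \<partial>M)"
      by (intro suminf_cong nn_integral_cong) (auto simp: S_def indicator_def)
    also have "\<dots> = (\<Sum>k. g (of_nat k) * ennreal (p k))"
      using law by (simp add: nn_integral_cmult_indicator emeasure_eq_measure S_def p_def)
    finally show ?thesis .
  qed
  have shift: "of_nat (Suc k) * ennreal (p (Suc k)) = ennreal l * ennreal (p k)" for k
  proof -
    have "real (Suc k) * p (Suc k) = l * p k"
      unfolding p_def by (simp add: field_simps del: of_nat_Suc)
    moreover have "p k \<ge> 0" for k
      using l by (simp add: p_def)
    ultimately show ?thesis
      using l by (simp add: ennreal_of_nat_eq_real_of_nat flip: ennreal_mult del: of_nat_Suc)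
  qed
  let ?f = "\<lambda>k. of_nat k * h (of_nat k) * ennreal (p k)"
  have "(\<integral>\<^sup>+\<omega>. X \<omega> * h (X \<omega>) \<partial>M) = (\<Sum>k. ?f k)"
    by (rule expand[of "\<lambda>x. x * h x"]) measurable
  also have "\<dots> = (\<Sum>k. ?f (Suc k))"
    using sums_Suc[of ?f "\<Sum>k. ?f (Suc k)"] by (simp add: sums_unique[symmetric] summable_sums)
  also have "\<dots> = (\<Sum>k. ennreal l * (h (of_nat k + 1) * ennreal (p k)))"
  proof (intro suminf_cong)
    fix k
    have "?f (Suc k) = h (of_nat k + 1) * (of_nat (Suc k) * ennreal (p (Suc k)))"
      by (simp add: ac_simps)
    then show "?f (Suc k) = ennreal l * (h (of_nat k + 1) * ennreal (p k))"
      unfolding shift by (simp add: ac_simps)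
  qed
  also have "\<dots> = ennreal l * (\<integral>\<^sup>+\<omega>. h (X \<omega> + 1) \<partial>M)"
    by (subst expand[of "\<lambda>x. h (x + 1)"]) (auto simp: ennreal_suminf_cmult)
  finally show ?thesis .
qed

text \<open>The absence of atoms enters as the vanishing of \<open>\<sigma>\<close> on points: a fixed point then almost surely
  lies outside the configuration, and the coordinates of a tuple are almost everywhere distinct.\<close>

locale diffuse_poisson = bounded_partition D + prob_space P
  for D :: "nat \<Rightarrow> 'a::{metric_space, second_countable_topology} set" and P :: "'a set measure" +
  fixes \<sigma> :: "'a measure"
  assumes sets_\<sigma> [measurable_cong]: "sets \<sigma> = sets borel"
    and \<sigma>_D_finite: "emeasure \<sigma> (D m) < \<infinity>"
    and \<sigma>_point: "emeasure \<sigma> {x} = 0"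
    and poisson: "poisson_random_measure \<sigma> P"
begin

lemma space_\<sigma>: "space \<sigma> = UNIV"
  using sets_eq_imp_space_eq[OF sets_\<sigma>] by simp

lemma sets_P [measurable_cong]: "sets P = sets config_space"
  using poisson by (simp add: poisson_random_measure_def)

lemma space_P: "space P = configurations"
  using sets_eq_imp_space_eq[OF sets_P] by simp

sublocale sigma: sigma_finite_measure \<sigma>
proof
  show "\<exists>A. countable A \<and> A \<subseteq> sets \<sigma> \<and> \<Union>A = space \<sigma> \<and> (\<forall>a\<in>A. emeasure \<sigma> a \<noteq> \<infinity>)"
    using UN_D \<sigma>_D_finite by (intro exI[of _ "range D"]) (auto simp: space_\<sigma> sets_\<sigma> less_top)
qed

sublocale sigma_P: pair_sigma_finite \<sigma> P ..

abbreviation count :: "'a set \<Rightarrow> 'a set \<Rightarrow> ennreal" where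
  "count \<omega> A \<equiv> emeasure (config_measure \<omega>) A"

lemma count_law:
  assumes "A \<in> sets borel" "emeasure \<sigma> A < \<infinity>"
  shows "prob {\<omega> \<in> space P. count \<omega> A = of_nat k} = exp (- measure \<sigma> A) * measure \<sigma> A ^ k / fact k"
  using poisson assms by (simp add: poisson_random_measure_def)

lemma AE_point_not_in_config: "AE \<omega> in P. x \<notin> \<omega>"
proof -
  have "prob {\<omega> \<in> space P. count \<omega> {x} = of_nat 0} = 1"
    using \<sigma>_point by (subst count_law) (auto simp: measure_def)
  then have "AE \<omega> in P. count \<omega> {x} = 0"
    by (subst (asm) prob_Collect_eq_1) auto
  then show ?thesis
    by eventually_elim (auto simp: emeasure_config_measure_eq_0_iff)
qed

lemma AE_finite_disjoint_config: "finite S \<Longrightarrow> AE \<omega> in P. \<omega> \<inter> S = {}"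
proof (induction S rule: finite_induct)
  case (insert x S)
  then show ?case
    using AE_point_not_in_config[of x] by auto
qed simp

text \<open>Counts over disjoint sets are independent, so one coordinate can be integrated on its own,
  where \<open>poisson_shift\<close> applies.\<close>

lemma counts_shift:
  fixes C :: "nat \<Rightarrow> 'a set" and g :: "(nat \<Rightarrow> ennreal) \<Rightarrow> ennreal"
  assumes C [measurable]: "\<And>j. C j \<in> sets borel" and disj: "disjoint_family_on C {..<m}"
    and i: "i < m" and fin: "emeasure \<sigma> (C i) < \<infinity>"
    and g [measurable]: "g \<in> borel_measurable (PiM {..<m} (\<lambda>_. borel))"
  shows "(\<integral>\<^sup>+\<omega>. count \<omega> (C i) * g (\<lambda>j\<in>{..<m}. count \<omega> (C j)) \<partial>P) =
    emeasure \<sigma> (C i) * (\<integral>\<^sup>+\<omega>. g (\<lambda>j\<in>{..<m}. count \<omega> (C j) + (if j = i then 1 else 0)) \<partial>P)"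
proof -
  define \<nu> where "\<nu> j = distr P borel (\<lambda>\<omega>. count \<omega> (C j))" for j
  define J where "J = {..<m} - {i}"
  have J: "finite J" "i \<notin> J" "insert i J = {..<m}"
    using i by (auto simp: J_def)
  interpret \<nu>: product_sigma_finite \<nu>
    unfolding product_sigma_finite_def \<nu>_def
    by (intro allI prob_space_imp_sigma_finite prob_space_distr) measurable
  have sets_\<nu>: "sets (\<nu> j) = sets borel" for j
    by (simp add: \<nu>_def)
  have "indep_vars (\<lambda>_. borel) (\<lambda>j \<omega>. count \<omega> (C j)) {..<m}"
    using poisson C disj by (simp add: poisson_random_measure_def)
  then have joint: "distr P (PiM {..<m} (\<lambda>_. borel)) (\<lambda>\<omega>. \<lambda>j\<in>{..<m}. count \<omega> (C j)) = PiM {..<m} \<nu>"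
    using i by (subst (asm) indep_vars_iff_distr_eq_PiM) (auto simp: \<nu>_def[abs_def])
  have update: "(\<lambda>t. v(i := t)) \<in> measurable borel (PiM {..<m} (\<lambda>_. borel))"
    if v: "v \<in> space (PiM J \<nu>)" for v
  proof (rule measurable_fun_upd)
    show "{..<m} = J \<union> {i}"
      using J by auto
    show "(\<lambda>t. v) \<in> measurable borel (PiM J (\<lambda>_. borel))"
      using v by (intro measurable_const) (simp add: space_PiM \<nu>_def)
  qed simp
  \<comment> \<open>The joint law of the counts is a product, so the \<open>i\<close>-th count can be resampled separately from
    the others.\<close>
  have isolate: "(\<integral>\<^sup>+\<omega>. G (\<lambda>j\<in>{..<m}. count \<omega> (C j)) \<partial>P) =
      (\<integral>\<^sup>+v. (\<integral>\<^sup>+\<omega>. G (v(i := count \<omega> (C i))) \<partial>P) \<partial>PiM J \<nu>)"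
    if G [measurable]: "G \<in> borel_measurable (PiM {..<m} (\<lambda>_. borel))" for G :: "_ \<Rightarrow> ennreal"
  proof -
    have G': "G \<in> borel_measurable (PiM {..<m} \<nu>)"
      using G by (simp add: sets_\<nu> cong: measurable_cong_sets sets_PiM_cong)
    have "(\<integral>\<^sup>+\<omega>. G (\<lambda>j\<in>{..<m}. count \<omega> (C j)) \<partial>P) = (\<integral>\<^sup>+v. G v \<partial>PiM {..<m} \<nu>)"
      unfolding joint[symmetric] by (subst nn_integral_distr) auto
    also have "\<dots> = (\<integral>\<^sup>+v. (\<integral>\<^sup>+t. G (v(i := t)) \<partial>\<nu> i) \<partial>PiM J \<nu>)"
      using G' \<nu>.product_nn_integral_insert[OF J(1,2), of G] by (simp add: J(3))
    also have "\<dots> = (\<integral>\<^sup>+v. (\<integral>\<^sup>+\<omega>. G (v(i := count \<omega> (C i))) \<partial>P) \<partial>PiM J \<nu>)"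
    proof (intro nn_integral_cong)
      fix v assume v: "v \<in> space (PiM J \<nu>)"
      have "(\<lambda>t. G (v(i := t))) \<in> borel_measurable borel"
        using update[OF v] G by (rule measurable_compose)
      then show "(\<integral>\<^sup>+t. G (v(i := t)) \<partial>\<nu> i) = (\<integral>\<^sup>+\<omega>. G (v(i := count \<omega> (C i))) \<partial>P)"
        unfolding \<nu>_def by (subst nn_integral_distr) auto
    qed
    finally show ?thesis .
  qed
  have "(\<integral>\<^sup>+\<omega>. count \<omega> (C i) * g (\<lambda>j\<in>{..<m}. count \<omega> (C j)) \<partial>P) =
      (\<integral>\<^sup>+v. (\<integral>\<^sup>+\<omega>. count \<omega> (C i) * g (v(i := count \<omega> (C i))) \<partial>P) \<partial>PiM J \<nu>)"
    using i isolate[of "\<lambda>v. v i * g v"] by simp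
  also have "\<dots> = (\<integral>\<^sup>+v. emeasure \<sigma> (C i) * (\<integral>\<^sup>+\<omega>. g (v(i := count \<omega> (C i) + 1)) \<partial>P) \<partial>PiM J \<nu>)"
  proof (intro nn_integral_cong)
    fix v assume v: "v \<in> space (PiM J \<nu>)"
    have "(\<lambda>t. g (v(i := t))) \<in> borel_measurable borel"
      using update[OF v] g by (rule measurable_compose)
    then have "(\<integral>\<^sup>+\<omega>. count \<omega> (C i) * g (v(i := count \<omega> (C i))) \<partial>P) =
        ennreal (measure \<sigma> (C i)) * (\<integral>\<^sup>+\<omega>. g (v(i := count \<omega> (C i) + 1)) \<partial>P)"
      using count_law[OF C fin]
      by (intro poisson_shift[where h="\<lambda>t. g (v(i := t))"]) (auto simp del: fun_upd_apply)
    also have "ennreal (measure \<sigma> (C i)) = emeasure \<sigma> (C i)"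
      using fin by (simp add: emeasure_eq_ennreal_measure less_top)
    finally show "(\<integral>\<^sup>+\<omega>. count \<omega> (C i) * g (v(i := count \<omega> (C i))) \<partial>P) =
        emeasure \<sigma> (C i) * (\<integral>\<^sup>+\<omega>. g (v(i := count \<omega> (C i) + 1)) \<partial>P)" .
  qed
  also have "\<dots> = (\<integral>\<^sup>+v. emeasure \<sigma> (C i) *
      (\<integral>\<^sup>+\<omega>. g (\<lambda>j\<in>{..<m}. (v(i := count \<omega> (C i))) j + (if j = i then 1 else 0)) \<partial>P) \<partial>PiM J \<nu>)"
  proof (intro nn_integral_cong arg_cong2[where f="(*)"] refl arg_cong[where f=g] ext)
    fix v \<omega> j assume "v \<in> space (PiM J \<nu>)"
    then show "(v(i := count \<omega> (C i) + 1)) j =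
        (\<lambda>j\<in>{..<m}. (v(i := count \<omega> (C i))) j + (if j = i then 1 else 0)) j"
      using i by (auto simp: space_PiM J_def PiE_def extensional_def)
  qed
  also have "\<dots> = emeasure \<sigma> (C i) * (\<integral>\<^sup>+v.
      (\<integral>\<^sup>+\<omega>. g (\<lambda>j\<in>{..<m}. (v(i := count \<omega> (C i))) j + (if j = i then 1 else 0)) \<partial>P) \<partial>PiM J \<nu>)"
  proof (rule nn_integral_cmult)
    have "(\<lambda>p. (fst p)(i := count (snd p) (C i))) \<in>
        measurable (PiM J \<nu> \<Otimes>\<^sub>M P) (PiM {..<m} (\<lambda>_. borel))"
    proof (rule measurable_fun_upd)
      show "{..<m} = J \<union> {i}"
        using J by auto
      have [measurable_cong]: "sets (PiM J \<nu>) = sets (PiM J (\<lambda>_. borel))"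
        by (intro sets_PiM_cong refl sets_\<nu>)
      show "fst \<in> measurable (PiM J \<nu> \<Otimes>\<^sub>M P) (PiM J (\<lambda>_. borel))"
        by measurable
    qed measurable
    then have "(\<lambda>p. g (\<lambda>j\<in>{..<m}. ((fst p)(i := count (snd p) (C i))) j + (if j = i then 1 else 0)))
        \<in> borel_measurable (PiM J \<nu> \<Otimes>\<^sub>M P)"
      by measurable
    then show "(\<lambda>v. \<integral>\<^sup>+\<omega>. g (\<lambda>j\<in>{..<m}. (v(i := count \<omega> (C i))) j + (if j = i then 1 else 0)) \<partial>P)
        \<in> borel_measurable (PiM J \<nu>)"
      by (intro borel_measurable_nn_integral) (simp add: case_prod_beta')
  qed
  also have "\<dots> = emeasure \<sigma> (C i) *
      (\<integral>\<^sup>+\<omega>. g (\<lambda>j\<in>{..<m}. (\<lambda>j\<in>{..<m}. count \<omega> (C j)) j + (if j = i then 1 else 0)) \<partial>P)"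
    by (subst isolate[of "\<lambda>v. g (\<lambda>j\<in>{..<m}. v j + (if j = i then 1 else 0))"]) auto
  also have "\<dots> = emeasure \<sigma> (C i) *
      (\<integral>\<^sup>+\<omega>. g (\<lambda>j\<in>{..<m}. count \<omega> (C j) + (if j = i then 1 else 0)) \<partial>P)"
    by (simp cong: restrict_cong)
  finally show ?thesis .
qed

end

section \<open>The Mecke formula\<close>

text \<open>The events that restrict finitely many counts: unlike the generator in the definition of the
  configuration space they are closed under intersection.\<close>

definition count_cylinders :: "'a::topological_space set set set" where
  "count_cylinders = {{\<omega> \<in> configurations. \<forall>l<r. emeasure (config_measure \<omega>) (A l) \<in> B l} |
     (r::nat) A B. \<forall>l. A l \<in> sets borel \<and> B l \<in> sets borel}"

lemma count_cylindersE:
  assumes "E \<in> count_cylinders"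
  obtains r A B where "E = {\<omega> \<in> configurations. \<forall>l<(r::nat). emeasure (config_measure \<omega>) (A l) \<in> B l}"
    "\<forall>l. A l \<in> sets borel \<and> B l \<in> sets borel"
  using assms unfolding count_cylinders_def mem_Collect_eq by (elim exE conjE)

lemma Int_stable_count_cylinders: "Int_stable count_cylinders"
proof (rule Int_stableI)
  fix E E' :: "'a set set" assume "E \<in> count_cylinders" "E' \<in> count_cylinders"
  from \<open>E \<in> count_cylinders\<close> obtain r :: nat and A B
    where E: "E = {\<omega> \<in> configurations. \<forall>l<r. emeasure (config_measure \<omega>) (A l) \<in> B l}"
      and AB: "\<forall>l. A l \<in> sets borel \<and> B l \<in> sets borel"
    by (rule count_cylindersE)
  from \<open>E' \<in> count_cylinders\<close> obtain r' :: nat and A' B'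
    where E': "E' = {\<omega> \<in> configurations. \<forall>l<r'. emeasure (config_measure \<omega>) (A' l) \<in> B' l}"
      and AB': "\<forall>l. A' l \<in> sets borel \<and> B' l \<in> sets borel"
    by (rule count_cylindersE)
  define A'' where "A'' l = (if l < r then A l else A' (l - r))" for l
  define B'' where "B'' l = (if l < r then B l else B' (l - r))" for l
  have split: "(\<forall>l<r + r'. Q l) \<longleftrightarrow> (\<forall>l<r. Q l) \<and> (\<forall>l<r'. Q (r + l))" for Q
    by (metis add_less_cancel_left le_add_diff_inverse not_less trans_less_add1)
  have "E \<inter> E' = {\<omega> \<in> configurations. \<forall>l<r + r'. emeasure (config_measure \<omega>) (A'' l) \<in> B'' l}"
    unfolding E E' split by (auto simp: A''_def B''_def)
  moreover have "\<forall>l. A'' l \<in> sets borel \<and> B'' l \<in> sets borel"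
    using AB AB' by (simp add: A''_def B''_def)
  ultimately show "E \<inter> E' \<in> count_cylinders"
    unfolding count_cylinders_def by blast
qed

lemma count_cylinders_subset: "count_cylinders \<subseteq> sets config_space"
proof
  fix E :: "'a set set" assume "E \<in> count_cylinders"
  then obtain r :: nat and A B where E: "E = {\<omega> \<in> configurations. \<forall>l<r. emeasure (config_measure \<omega>) (A l) \<in> B l}"
    and AB: "\<forall>l. A l \<in> sets borel \<and> B l \<in> sets borel"
    by (rule count_cylindersE)
  have [measurable]: "A l \<in> sets borel" "B l \<in> sets borel" for l
    using AB by auto
  have "{\<omega> \<in> space config_space. \<forall>l\<in>{..<r}. emeasure (config_measure \<omega>) (A l) \<in> B l} \<in> sets config_space"
    by measurable
  then show "E \<in> sets config_space"
    unfolding E Ball_def lessThan_iff space_config_space .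
qed

lemma sets_config_space_eq_cylinders:
  "sets config_space = sigma_sets (configurations :: 'a::topological_space set set) count_cylinders"
proof
  have *: "{{\<omega> \<in> configurations. emeasure (config_measure \<omega>) A \<in> B} | A B.
        A \<in> sets borel \<and> B \<in> sets borel} \<subseteq> (count_cylinders :: 'a set set set)"
  proof clarify
    fix A :: "'a set" and B :: "ennreal set" assume "A \<in> sets borel" "B \<in> sets borel"
    then show "{\<omega> \<in> configurations. emeasure (config_measure \<omega>) A \<in> B} \<in> count_cylinders"
      unfolding count_cylinders_def
      by (intro CollectI exI[of _ 1] exI[of _ "\<lambda>_. A"] exI[of _ "\<lambda>_. B"]) auto
  qed
  have "sets config_space = sigma_sets configurations {{\<omega> \<in> configurations. emeasure (config_measure \<omega>) A \<in> B} | A B.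
        (A :: 'a set) \<in> sets borel \<and> B \<in> sets borel}"
    unfolding config_space_def by (rule sets_measure_of) auto
  also have "\<dots> \<subseteq> sigma_sets configurations count_cylinders"
    by (rule sigma_sets_mono') (rule *)
  finally show "sets config_space \<subseteq> sigma_sets (configurations :: 'a set set) count_cylinders" .
  show "sigma_sets configurations count_cylinders \<subseteq> sets (config_space :: 'a set measure)"
    using sets.sigma_sets_subset[OF count_cylinders_subset] by simp
qed

context diffuse_poisson
begin

text \<open>For a cylinder event the sets involved generate a finite partition of the space into cells,
  coded by numbers whose binary digits say in which of the sets the cell lies. The event and the
  count of \<open>A\<close> depend only on the counts of the cells, so the claim becomes a sum of instances of
  \<open>counts_shift\<close>: adding a point in a cell raises the count of this cell by one, almost surely.\<close>

lemma mecke_cylinder: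
  assumes A: "A \<in> sets borel" "emeasure \<sigma> A < \<infinity>" and E: "E \<in> count_cylinders"
  shows "(\<integral>\<^sup>+\<omega>. count \<omega> A * indicator E \<omega> \<partial>P) = (\<integral>\<^sup>+x\<in>A. (\<integral>\<^sup>+\<omega>. indicator E (insert x \<omega>) \<partial>P) \<partial>\<sigma>)"
proof -
  obtain r :: nat and A0 B where E_eq: "E = {\<omega> \<in> configurations. \<forall>l<r. count \<omega> (A0 l) \<in> B l}"
    and A0B: "\<forall>l. A0 l \<in> sets borel \<and> B l \<in> sets borel"
    using E by (rule count_cylindersE)
  have A0: "A0 l \<in> sets borel" and B [measurable]: "B l \<in> sets borel" for l
    using A0B by auto
  define A' where "A' l = (if l = r then A else A0 l)" for l
  have A'_borel [measurable]: "A' l \<in> sets borel" for l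
    using A A0 by (simp add: A'_def)
  \<comment> \<open>Treating \<open>A\<close> as one more set, number \<open>r\<close>, makes it a union of cells as well.\<close>
  define t where "t x = set_encode {l. l \<le> r \<and> x \<in> A' l}" for x
  define C where "C j = t -` {j}" for j
  define m where "m = Suc (set_encode {..r})"
  define J where "J l = {j. j < m \<and> l \<in> set_decode j}" for l
  have dec: "set_decode (t x) = {l. l \<le> r \<and> x \<in> A' l}" for x
    unfolding t_def by (intro set_encode_inverse) auto
  have t_less: "t x < m" for x
    unfolding m_def less_Suc_eq_le by (intro subset_decode_imp_le) (auto simp: dec)
  have C_eq: "C j = {x. \<forall>l. (l \<le> r \<and> x \<in> A' l) \<longleftrightarrow> l \<in> set_decode j}" for j
  proof -
    have "t x = j \<longleftrightarrow> set_decode (t x) = set_decode j" for x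
      by (metis set_decode_inverse)
    then show ?thesis
      unfolding C_def by (auto simp: dec)
  qed
  have C_borel [measurable]: "C j \<in> sets borel" for j
    unfolding C_eq by measurable
  have disj_C: "disjoint_family_on C X" for X
    by (auto simp: disjoint_family_on_def C_def)
  have A'_eq: "A' l = (\<Union>j\<in>J l. C j)" if "l \<le> r" for l
    using that t_less by (auto simp: J_def C_def dec)
  have finite_J: "finite (J l)" for l
    by (simp add: J_def)
  have count_A': "count \<omega> (A' l) = (\<Sum>j\<in>J l. count \<omega> (C j))" if "l \<le> r" for l \<omega>
    unfolding A'_eq[OF that] using finite_J disj_C by (intro sum_emeasure[symmetric]) auto
  have J_less: "j < m" if "j \<in> J l" for j l
    using that by (simp add: J_def)
  have C_sub: "C j \<subseteq> A" if "j \<in> J r" for j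
    using A'_eq[of r] that by (auto simp: A'_def)
  have fin_C: "emeasure \<sigma> (C j) < \<infinity>" if "j \<in> J r" for j
    using emeasure_mono[OF C_sub[OF that], of \<sigma>] A by (auto simp: sets_\<sigma> intro: le_less_trans)
  define V where "V = {v \<in> space (PiM {..<m} (\<lambda>_. borel)). \<forall>l\<in>{..<r}. (\<Sum>j\<in>J l. v j) \<in> B l}"
  have V [measurable]: "V \<in> sets (PiM {..<m} (\<lambda>_. borel))"
  proof -
    have "(\<lambda>v. \<Sum>j\<in>J l. v j) \<in> borel_measurable (PiM {..<m} (\<lambda>_. borel :: ennreal measure))" for l
      by (intro borel_measurable_sum measurable_component_singleton) (simp add: J_less)
    then show ?thesis
      unfolding V_def by measurable
  qed
  have V_iff: "(\<lambda>j\<in>{..<m}. v j) \<in> V \<longleftrightarrow> (\<forall>l<r. (\<Sum>j\<in>J l. v j) \<in> B l)" for v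
  proof -
    have "(\<Sum>j\<in>J l. (\<lambda>j\<in>{..<m}. v j) j) = (\<Sum>j\<in>J l. v j)" for l
      by (intro sum.cong) (auto simp: J_less)
    then show ?thesis
      by (auto simp: V_def space_PiM)
  qed
  \<comment> \<open>the probability of the event after a point has been added in cell \<open>i\<close>\<close>
  define K where "K i = (\<integral>\<^sup>+\<omega>. indicator V (\<lambda>j\<in>{..<m}. count \<omega> (C j) + (if j = i then 1 else 0)) \<partial>P)" for i
  have E_iff: "\<omega> \<in> E \<longleftrightarrow> (\<forall>l<r. (\<Sum>j\<in>J l. count \<omega> (C j)) \<in> B l)" if "\<omega> \<in> configurations" for \<omega>
    using that by (auto simp: E_eq A'_def simp flip: count_A' )
  have "(\<integral>\<^sup>+\<omega>. count \<omega> A * indicator E \<omega> \<partial>P) =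
      (\<integral>\<^sup>+\<omega>. (\<Sum>i\<in>J r. count \<omega> (C i) * indicator V (\<lambda>j\<in>{..<m}. count \<omega> (C j))) \<partial>P)"
  proof (intro nn_integral_cong)
    fix \<omega> assume "\<omega> \<in> space P"
    then have "(indicator E \<omega> :: ennreal) = indicator V (\<lambda>j\<in>{..<m}. count \<omega> (C j))"
      by (simp add: indicator_def E_iff V_iff space_P)
    moreover have "count \<omega> A = (\<Sum>i\<in>J r. count \<omega> (C i))"
      using count_A'[of r \<omega>] by (simp add: A'_def)
    ultimately show "count \<omega> A * indicator E \<omega> =
        (\<Sum>i\<in>J r. count \<omega> (C i) * indicator V (\<lambda>j\<in>{..<m}. count \<omega> (C j)))"
      by (simp add: sum_distrib_right)
  qed
  also have "\<dots> = (\<Sum>i\<in>J r. \<integral>\<^sup>+\<omega>. count \<omega> (C i) * indicator V (\<lambda>j\<in>{..<m}. count \<omega> (C j)) \<partial>P)"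
    by (intro nn_integral_sum) measurable
  also have "\<dots> = (\<Sum>i\<in>J r. emeasure \<sigma> (C i) * K i)"
    unfolding K_def using fin_C disj_C by (intro sum.cong refl counts_shift) (auto simp: J_less)
  also have "\<dots> = (\<integral>\<^sup>+x. (\<Sum>i\<in>J r. K i * indicator (C i) x) \<partial>\<sigma>)"
    by (subst nn_integral_sum) (auto simp: sets_\<sigma> nn_integral_cmult_indicator mult.commute)
  also have "\<dots> = (\<integral>\<^sup>+x\<in>A. (\<integral>\<^sup>+\<omega>. indicator E (insert x \<omega>) \<partial>P) \<partial>\<sigma>)"
  proof (intro nn_integral_cong)
    fix x
    have "(\<integral>\<^sup>+\<omega>. indicator E (insert x \<omega>) \<partial>P) = K (t x)"
      unfolding K_def
    proof (intro nn_integral_cong_AE)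
      show "AE \<omega> in P. indicator E (insert x \<omega>) =
          (indicator V (\<lambda>j\<in>{..<m}. count \<omega> (C j) + (if j = t x then 1 else 0)) :: ennreal)"
        using AE_point_not_in_config[of x] AE_space
      proof eventually_elim
        case (elim \<omega>)
        have "count (insert x \<omega>) (C j) = count \<omega> (C j) + (if j = t x then 1 else 0)" for j
          using emeasure_config_measure_insert[OF C_borel elim(1)] by (simp add: indicator_def C_def)
        then have "insert x \<omega> \<in> E \<longleftrightarrow>
            (\<lambda>j\<in>{..<m}. count \<omega> (C j) + (if j = t x then 1 else 0)) \<in> V"
          using elim by (simp add: E_iff V_iff configuration_insert space_P)
        then show ?case
          by (simp add: indicator_def)
      qed
    qed
    moreover have "(\<Sum>i\<in>J r. K i * indicator (C i) x) = (\<Sum>i\<in>J r. if i = t x then K (t x) else 0)"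
      by (intro sum.cong) (auto simp: indicator_def C_def)
    moreover have "t x \<in> J r \<longleftrightarrow> x \<in> A"
      using t_less by (auto simp: J_def dec A'_def)
    ultimately show "(\<Sum>i\<in>J r. K i * indicator (C i) x) =
        (\<integral>\<^sup>+\<omega>. indicator E (insert x \<omega>) \<partial>P) * indicator A x"
      using finite_J by (simp add: sum.delta)
  qed
  finally show ?thesis .
qed

text \<open>Both sides are measures in \<open>E\<close>: the law of the configuration weighted by its count of \<open>A\<close>, and
  the law of the configuration with an added point distributed according to \<open>\<sigma>\<close> on \<open>A\<close>. They agree on
  the cylinder events and have the finite mass \<open>\<sigma> A\<close>, hence coincide.\<close>

lemma mecke_rectangle:
  assumes A [measurable]: "A \<in> sets borel" and fin: "emeasure \<sigma> A < \<infinity>" and E: "E \<in> sets config_space"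
  shows "(\<integral>\<^sup>+\<omega>. count \<omega> A * indicator E \<omega> \<partial>P) = (\<integral>\<^sup>+x\<in>A. (\<integral>\<^sup>+\<omega>. indicator E (insert x \<omega>) \<partial>P) \<partial>\<sigma>)"
proof -
  define M1 where "M1 = density P (\<lambda>\<omega>. count \<omega> A)"
  define M2 where "M2 = distr (restrict_space \<sigma> A \<Otimes>\<^sub>M P) config_space (\<lambda>(x, \<omega>). insert x \<omega>)"
  have A': "A \<inter> space \<sigma> \<in> sets \<sigma>"
    by (simp add: sets_\<sigma> space_\<sigma>)
  have ins [measurable]: "(\<lambda>(x, \<omega>). insert x \<omega>) \<in> measurable (restrict_space \<sigma> A \<Otimes>\<^sub>M P) config_space"
  proof -
    have "(\<lambda>p. insert (fst p) (snd p)) \<in> measurable (restrict_space \<sigma> A \<Otimes>\<^sub>M P) config_space"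
    proof (rule measurable_insert_config')
      have "(\<lambda>x. x) \<in> measurable (restrict_space \<sigma> A) borel"
        by (rule measurable_restrict_space1) (simp add: measurable_ident_sets sets_\<sigma>)
      then show "fst \<in> measurable (restrict_space \<sigma> A \<Otimes>\<^sub>M P) borel"
        by measurable
    qed measurable
    then show ?thesis
      by (simp add: case_prod_beta')
  qed
  have M1: "emeasure M1 E = (\<integral>\<^sup>+\<omega>. count \<omega> A * indicator E \<omega> \<partial>P)" if "E \<in> sets config_space" for E
    unfolding M1_def using that by (intro emeasure_density) (auto simp: sets_P)
  have M2: "emeasure M2 E = (\<integral>\<^sup>+x\<in>A. (\<integral>\<^sup>+\<omega>. indicator E (insert x \<omega>) \<partial>P) \<partial>\<sigma>)"
    if [measurable]: "E \<in> sets config_space" for E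
  proof -
    have "emeasure M2 E = (\<integral>\<^sup>+\<omega>. indicator E \<omega> \<partial>M2)"
      using that by (simp add: M2_def)
    also have "\<dots> = (\<integral>\<^sup>+p. indicator E (case p of (x, \<omega>) \<Rightarrow> insert x \<omega>) \<partial>(restrict_space \<sigma> A \<Otimes>\<^sub>M P))"
      unfolding M2_def by (subst nn_integral_distr) auto
    also have "\<dots> = (\<integral>\<^sup>+x. (\<integral>\<^sup>+\<omega>. indicator E (insert x \<omega>) \<partial>P) \<partial>restrict_space \<sigma> A)"
      by (subst nn_integral_fst[symmetric]) auto
    also have "\<dots> = (\<integral>\<^sup>+x\<in>A. (\<integral>\<^sup>+\<omega>. indicator E (insert x \<omega>) \<partial>P) \<partial>\<sigma>)"
      using A' by (rule nn_integral_restrict_space)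
    finally show ?thesis .
  qed
  have top: "configurations \<in> count_cylinders"
    unfolding count_cylinders_def
    by (intro CollectI exI[of _ 0] exI[of _ "\<lambda>_. {}"] exI[of _ "\<lambda>_. {}"]) auto
  have gen: "emeasure M1 E = emeasure M2 E" if "E \<in> count_cylinders" for E
    using that count_cylinders_subset mecke_cylinder[OF A fin that] by (auto simp: M1 M2)
  have "M1 = M2"
  proof (rule measure_eqI_generator_eq[OF Int_stable_count_cylinders _ gen])
    show "count_cylinders \<subseteq> Pow (configurations :: 'a set set)"
      by (auto simp: count_cylinders_def)
    show "sets M1 = sigma_sets configurations count_cylinders"
      "sets M2 = sigma_sets configurations count_cylinders"
      by (simp_all add: M1_def M2_def sets_P sets_config_space_eq_cylinders)
    show "range (\<lambda>_::nat. configurations) \<subseteq> (count_cylinders :: 'a set set set)"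
      using top by auto
    show "emeasure M1 configurations \<noteq> \<infinity>" for i :: nat
    proof -
      have "emeasure M1 configurations = emeasure M2 configurations"
        by (rule gen[OF top])
      also have "\<dots> = (\<integral>\<^sup>+x\<in>A. (\<integral>\<^sup>+\<omega>. indicator configurations (insert x \<omega>) \<partial>P) \<partial>\<sigma>)"
        using top count_cylinders_subset by (intro M2) blast
      also have "\<dots> \<le> (\<integral>\<^sup>+x\<in>A. (\<integral>\<^sup>+\<omega>. 1 \<partial>P) \<partial>\<sigma>)"
        by (intro nn_integral_mono mult_right_mono) (auto simp: indicator_def)
      also have "\<dots> = emeasure \<sigma> A"
        by (simp add: emeasure_space_1 sets_\<sigma>)
      finally show ?thesis
        using fin by auto
    qed
  qed auto
  then show ?thesis
    using M1[OF E] M2[OF E] by simp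
qed

text \<open>The measurability needed for linearity and monotone convergence in both iterated integrals of
  the Mecke formula.\<close>

lemma measurable_config_sections:
  fixes u :: "'a \<times> 'a set \<Rightarrow> ennreal"
  assumes u [measurable]: "u \<in> borel_measurable (borel \<Otimes>\<^sub>M config_space)"
  shows "\<omega> \<in> configurations \<Longrightarrow> (\<lambda>x. u (x, \<omega>)) \<in> borel_measurable (config_measure \<omega>)"
    and "(\<lambda>\<omega>. \<integral>\<^sup>+x. u (x, \<omega>) \<partial>config_measure \<omega>) \<in> borel_measurable P"
    and "(\<lambda>\<omega>. u (x, insert x \<omega>)) \<in> borel_measurable P"
    and "(\<lambda>x. \<integral>\<^sup>+\<omega>. u (x, insert x \<omega>) \<partial>P) \<in> borel_measurable \<sigma>"
proof -
  show "(\<lambda>x. u (x, \<omega>)) \<in> borel_measurable (config_measure \<omega>)" if "\<omega> \<in> configurations"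
  proof -
    have "(\<lambda>x. (x, \<omega>)) \<in> measurable borel (borel \<Otimes>\<^sub>M config_space)"
      using that by (intro measurable_Pair measurable_const) auto
    then have "(\<lambda>x. u (x, \<omega>)) \<in> borel_measurable borel"
      using u by (rule measurable_compose)
    then show ?thesis
      by simp
  qed
  show "(\<lambda>\<omega>. \<integral>\<^sup>+x. u (x, \<omega>) \<partial>config_measure \<omega>) \<in> borel_measurable P"
    by (rule measurable_nn_integral_config) measurable
  show "(\<lambda>\<omega>. u (x, insert x \<omega>)) \<in> borel_measurable P"
    by measurable
  show "(\<lambda>x. \<integral>\<^sup>+\<omega>. u (x, insert x \<omega>) \<partial>P) \<in> borel_measurable \<sigma>"
    by measurable
qed

text \<open>The Mecke formula: seen from one of its points, a Poisson configuration looks like an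
  independent Poisson configuration with this point added. Both sides are additive, homogeneous and
  continuous from below in \<open>G\<close>, so it suffices to compare them on indicators of rectangles. As these
  are a generator but not all measurable sets, complements have to be subtracted, which is possible
  over one piece \<open>D m\<close>, where the total mass is finite.\<close>

lemma mecke:
  fixes G :: "'a \<Rightarrow> 'a set \<Rightarrow> ennreal"
  assumes G: "(\<lambda>(x, \<omega>). G x \<omega>) \<in> borel_measurable (borel \<Otimes>\<^sub>M config_space)"
  shows "(\<integral>\<^sup>+\<omega>. (\<integral>\<^sup>+x. G x \<omega> \<partial>config_measure \<omega>) \<partial>P) = (\<integral>\<^sup>+x. (\<integral>\<^sup>+\<omega>. G x (insert x \<omega>) \<partial>P) \<partial>\<sigma>)"
proof -
  let ?H = "borel_measurable (borel \<Otimes>\<^sub>M config_space) :: ('a \<times> 'a set \<Rightarrow> ennreal) set"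
  define L where "L u = (\<integral>\<^sup>+\<omega>. (\<integral>\<^sup>+x. u (x, \<omega>) \<partial>config_measure \<omega>) \<partial>P)" for u :: "'a \<times> 'a set \<Rightarrow> ennreal"
  define R where "R u = (\<integral>\<^sup>+x. (\<integral>\<^sup>+\<omega>. u (x, insert x \<omega>) \<partial>P) \<partial>\<sigma>)" for u :: "'a \<times> 'a set \<Rightarrow> ennreal"
  note sections = measurable_config_sections
  have L_cong: "L u = L v" and R_cong: "R u = R v"
    if "\<And>x \<omega>. \<omega> \<in> configurations \<Longrightarrow> u (x, \<omega>) = v (x, \<omega>)" for u v
    unfolding L_def R_def using that
    by (auto intro!: nn_integral_cong simp: space_P configuration_insert)
  have L_add: "L (\<lambda>p. u p + v p) = L u + L v" and R_add: "R (\<lambda>p. u p + v p) = R u + R v"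
    if uv: "u \<in> ?H" "v \<in> ?H" for u v
  proof -
    have "L (\<lambda>p. u p + v p) =
        (\<integral>\<^sup>+\<omega>. (\<integral>\<^sup>+x. u (x, \<omega>) \<partial>config_measure \<omega>) + (\<integral>\<^sup>+x. v (x, \<omega>) \<partial>config_measure \<omega>) \<partial>P)"
      unfolding L_def using uv by (intro nn_integral_cong nn_integral_add sections(1)) (auto simp: space_P)
    also have "\<dots> = L u + L v"
      unfolding L_def using uv by (intro nn_integral_add sections(2))
    finally show "L (\<lambda>p. u p + v p) = L u + L v" .
    have "R (\<lambda>p. u p + v p) = (\<integral>\<^sup>+x. (\<integral>\<^sup>+\<omega>. u (x, insert x \<omega>) \<partial>P) + (\<integral>\<^sup>+\<omega>. v (x, insert x \<omega>) \<partial>P) \<partial>\<sigma>)"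
      unfolding R_def using uv by (intro nn_integral_cong nn_integral_add sections(3))
    also have "\<dots> = R u + R v"
      unfolding R_def using uv by (intro nn_integral_add sections(4))
    finally show "R (\<lambda>p. u p + v p) = R u + R v" .
  qed
  have L_cmult: "L (\<lambda>p. c * u p) = c * L u" and R_cmult: "R (\<lambda>p. c * u p) = c * R u"
    if u: "u \<in> ?H" for u and c :: ennreal
  proof -
    have "L (\<lambda>p. c * u p) = (\<integral>\<^sup>+\<omega>. c * (\<integral>\<^sup>+x. u (x, \<omega>) \<partial>config_measure \<omega>) \<partial>P)"
      unfolding L_def using u by (intro nn_integral_cong nn_integral_cmult sections(1)) (auto simp: space_P)
    also have "\<dots> = c * L u"
      unfolding L_def using u by (intro nn_integral_cmult sections(2))
    finally show "L (\<lambda>p. c * u p) = c * L u" .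
    have "R (\<lambda>p. c * u p) = (\<integral>\<^sup>+x. c * (\<integral>\<^sup>+\<omega>. u (x, insert x \<omega>) \<partial>P) \<partial>\<sigma>)"
      unfolding R_def using u by (intro nn_integral_cong nn_integral_cmult sections(3))
    also have "\<dots> = c * R u"
      unfolding R_def using u by (intro nn_integral_cmult sections(4))
    finally show "R (\<lambda>p. c * u p) = c * R u" .
  qed
  have L_suminf: "L (\<lambda>p. \<Sum>i. U i p) = (\<Sum>i. L (U i))" and R_suminf: "R (\<lambda>p. \<Sum>i. U i p) = (\<Sum>i. R (U i))"
    if U: "\<And>i::nat. U i \<in> ?H" for U
  proof -
    have "L (\<lambda>p. \<Sum>i. U i p) = (\<integral>\<^sup>+\<omega>. (\<Sum>i. \<integral>\<^sup>+x. U i (x, \<omega>) \<partial>config_measure \<omega>) \<partial>P)"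
      unfolding L_def using U
      by (intro nn_integral_cong nn_integral_suminf sections(1)) (auto simp: space_P)
    also have "\<dots> = (\<Sum>i. L (U i))"
      unfolding L_def using U by (intro nn_integral_suminf sections(2))
    finally show "L (\<lambda>p. \<Sum>i. U i p) = (\<Sum>i. L (U i))" .
    have "R (\<lambda>p. \<Sum>i. U i p) = (\<integral>\<^sup>+x. (\<Sum>i. \<integral>\<^sup>+\<omega>. U i (x, insert x \<omega>) \<partial>P) \<partial>\<sigma>)"
      unfolding R_def using U by (intro nn_integral_cong nn_integral_suminf sections(3))
    also have "\<dots> = (\<Sum>i. R (U i))"
      unfolding R_def using U by (intro nn_integral_suminf sections(4))
    finally show "R (\<lambda>p. \<Sum>i. U i p) = (\<Sum>i. R (U i))" .
  qed
  have L_SUP: "L (\<lambda>p. SUP i. U i p) = (SUP i. L (U i))" and R_SUP: "R (\<lambda>p. SUP i. U i p) = (SUP i. R (U i))"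
    if U: "\<And>i::nat. U i \<in> ?H" and inc: "incseq U" for U
  proof -
    have "L (\<lambda>p. SUP i. U i p) = (\<integral>\<^sup>+\<omega>. (SUP i. \<integral>\<^sup>+x. U i (x, \<omega>) \<partial>config_measure \<omega>) \<partial>P)"
      unfolding L_def using U inc
      by (intro nn_integral_cong nn_integral_monotone_convergence_SUP sections(1))
        (auto simp: space_P incseq_def le_fun_def)
    also have "\<dots> = (SUP i. L (U i))"
      unfolding L_def using U inc
      by (intro nn_integral_monotone_convergence_SUP sections(2))
        (auto simp: incseq_def le_fun_def intro!: nn_integral_mono)
    finally show "L (\<lambda>p. SUP i. U i p) = (SUP i. L (U i))" .
    have "R (\<lambda>p. SUP i. U i p) = (\<integral>\<^sup>+x. (SUP i. \<integral>\<^sup>+\<omega>. U i (x, insert x \<omega>) \<partial>P) \<partial>\<sigma>)"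
      unfolding R_def using U inc
      by (intro nn_integral_cong nn_integral_monotone_convergence_SUP sections(3))
        (auto simp: incseq_def le_fun_def)
    also have "\<dots> = (SUP i. R (U i))"
      unfolding R_def using U inc
      by (intro nn_integral_monotone_convergence_SUP sections(4))
        (auto simp: incseq_def le_fun_def intro!: nn_integral_mono)
    finally show "R (\<lambda>p. SUP i. U i p) = (SUP i. R (U i))" .
  qed

  have rectangle: "L (indicator (A \<times> E)) = R (indicator (A \<times> E))"
    if A [measurable]: "A \<in> sets borel" and fin: "emeasure \<sigma> A < \<infinity>" and E: "E \<in> sets config_space" for A E
  proof -
    have "L (indicator (A \<times> E)) = (\<integral>\<^sup>+\<omega>. count \<omega> A * indicator E \<omega> \<partial>P)"
      unfolding L_def
    proof (intro nn_integral_cong)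
      fix \<omega>
      have "(\<integral>\<^sup>+x. indicator (A \<times> E) (x, \<omega>) \<partial>config_measure \<omega>) =
          (\<integral>\<^sup>+x. indicator E \<omega> * indicator A x \<partial>config_measure \<omega>)"
        by (simp add: indicator_times mult.commute)
      also have "\<dots> = count \<omega> A * indicator E \<omega>"
        by (subst nn_integral_cmult_indicator) (auto simp: mult.commute)
      finally show "(\<integral>\<^sup>+x. indicator (A \<times> E) (x, \<omega>) \<partial>config_measure \<omega>) = count \<omega> A * indicator E \<omega>" .
    qed
    also have "\<dots> = (\<integral>\<^sup>+x\<in>A. (\<integral>\<^sup>+\<omega>. indicator E (insert x \<omega>) \<partial>P) \<partial>\<sigma>)"
      by (rule mecke_rectangle[OF A fin E])
    also have "\<dots> = R (indicator (A \<times> E))"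
      unfolding R_def by (intro nn_integral_cong) (auto simp: indicator_times indicator_def)
    finally show ?thesis .
  qed

  \<comment> \<open>Monotone class argument over the piece \<open>D m\<close>.\<close>
  have on_piece: "L (\<lambda>p. u p * indicator (D m) (fst p)) = R (\<lambda>p. u p * indicator (D m) (fst p))"
    if "u \<in> ?H" for u m
    using that
  proof (induction u)
    case (cong f g)
    have "L (\<lambda>p. f p * indicator (D m) (fst p)) = L (\<lambda>p. g p * indicator (D m) (fst p))"
      "R (\<lambda>p. f p * indicator (D m) (fst p)) = R (\<lambda>p. g p * indicator (D m) (fst p))"
      using cong(3) by (auto intro!: L_cong R_cong simp: space_pair_measure)
    then show ?case
      using cong(4) by simp
  next
    case (set S)
    have closed: "{A \<times> E | A E. A \<in> sets borel \<and> E \<in> sets config_space} \<subseteq>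
        Pow (UNIV \<times> configurations :: ('a \<times> 'a set) set)"
      using sets.sets_into_space[of _ config_space] by auto
    have "S \<in> sigma_sets (UNIV \<times> configurations) {A \<times> E | A E. A \<in> sets borel \<and> E \<in> sets config_space}"
      using set unfolding sets_pair_measure by simp
    with Int_stable_pair_measure_generator[of borel config_space] closed show ?case
    proof (induction S rule: sigma_sets_induct_disjoint)
      case (basic S)
      then obtain A E where S: "S = A \<times> E" "A \<in> sets borel" "E \<in> sets config_space"
        by blast
      have "(\<lambda>p. indicator S p * indicator (D m) (fst p)) = (indicator ((A \<inter> D m) \<times> E) :: _ \<Rightarrow> ennreal)"
        by (auto simp: S indicator_def fun_eq_iff)
      moreover have "emeasure \<sigma> (A \<inter> D m) < \<infinity>"
        using emeasure_mono[of "A \<inter> D m" "D m" \<sigma>] \<sigma>_D_finite[of m] by (auto simp: sets_\<sigma> intro: le_less_trans)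
      ultimately show ?case
        using rectangle[of "A \<inter> D m" E] S by simp
    next
      case empty
      show ?case
        by (simp add: L_def R_def)
    next
      case (compl S)
      define v :: "'a \<times> 'a set \<Rightarrow> ennreal" where "v p = indicator S p * indicator (D m) (fst p)" for p
      define w :: "'a \<times> 'a set \<Rightarrow> ennreal" where "w p = indicator (UNIV \<times> configurations - S) p * indicator (D m) (fst p)" for p
      have S [measurable]: "S \<in> sets (borel \<Otimes>\<^sub>M config_space)"
        using compl(1) by (simp add: sets_pair_measure)
      have compl_S: "UNIV \<times> configurations - S \<in> sets (borel \<Otimes>\<^sub>M config_space)"
        using sets.compl_sets[OF S] by (simp add: space_pair_measure)
      have vw: "v \<in> ?H" "w \<in> ?H"
        unfolding v_def w_def using compl_S by measurable
      have cyl: "L (indicator (D m \<times> configurations)) = R (indicator (D m \<times> configurations))"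
        using \<sigma>_D_finite sets.top[of config_space] by (intro rectangle) auto
      have "L (\<lambda>p. v p + w p) = L (indicator (D m \<times> configurations))"
        by (intro L_cong) (auto simp: v_def w_def indicator_def)
      moreover have "R (\<lambda>p. v p + w p) = R (indicator (D m \<times> configurations))"
        by (intro R_cong) (auto simp: v_def w_def indicator_def)
      ultimately have sum: "L v + L w = R v + R w"
        using vw cyl by (simp add: L_add R_add)
      have "R v \<le> (\<integral>\<^sup>+x. (\<integral>\<^sup>+\<omega>. indicator (D m) x \<partial>P) \<partial>\<sigma>)"
        unfolding R_def v_def by (intro nn_integral_mono) (auto simp: indicator_def)
      also have "\<dots> < \<infinity>"
        using \<sigma>_D_finite by (simp add: emeasure_space_1 sets_\<sigma>)
      finally have "R v < \<infinity>" .
      with compl(2) sum have "L w = R w"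
        unfolding v_def[symmetric] by (auto simp: ennreal_add_left_cancel less_top)
      then show ?case
        by (simp add: w_def[abs_def])
    next
      case (union A)
      have A: "A i \<in> sets (borel \<Otimes>\<^sub>M config_space)" for i
        using union(2) by (auto simp: sets_pair_measure)
      then have H: "(\<lambda>p. indicator (A i) p * indicator (D m) (fst p)) \<in> ?H" for i
        by measurable
      have "(\<lambda>p. indicator (\<Union>i. A i) p * indicator (D m) (fst p)) =
          (\<lambda>p. \<Sum>i. indicator (A i) p * indicator (D m) (fst p) :: ennreal)"
        using suminf_indicator[OF union(1)] by (simp add: ennreal_suminf_multc)
      then show ?case
        using union(3) by (simp only: L_suminf[OF H] R_suminf[OF H])
    qed
  next
    case (mult u c)
    have "(\<lambda>p. u p * indicator (D m) (fst p)) \<in> ?H"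
      using mult.hyps by measurable
    then show ?case
      using mult.IH by (simp add: mult.assoc L_cmult R_cmult)
  next
    case (add u v)
    have "(\<lambda>p. u p * indicator (D m) (fst p)) \<in> ?H" "(\<lambda>p. v p * indicator (D m) (fst p)) \<in> ?H"
      using add.hyps by measurable
    then show ?case
      using add.IH by (simp add: distrib_right L_add R_add)
  next
    case (seq U)
    have H: "(\<lambda>p. U i p * indicator (D m) (fst p)) \<in> ?H" for i
      using seq.hyps(1) by measurable
    have inc: "incseq (\<lambda>i p. U i p * indicator (D m) (fst p))"
      using \<open>incseq U\<close> by (auto simp: incseq_def le_fun_def intro!: mult_right_mono)
    have "(\<lambda>p. (SUP i. U i) p * indicator (D m) (fst p)) = (\<lambda>p. SUP i. U i p * indicator (D m) (fst p))"
      by (simp add: SUP_mult_right_ennreal image_comp)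
    then show ?case
      using seq.IH by (simp only: L_SUP[OF H inc] R_SUP[OF H inc])
  qed

  define u where "u p = G (fst p) (snd p)" for p
  have u: "u \<in> ?H"
    using G by (simp add: u_def[abs_def] case_prod_beta')
  then have H: "(\<lambda>p. u p * indicator (D m) (fst p)) \<in> ?H" for m
    by measurable
  have "(\<lambda>p. \<Sum>m. u p * indicator (D m) (fst p)) = u"
    by (simp add: ennreal_suminf_cmult suminf_indicator[OF disjoint_D] UN_D)
  then have "L u = L (\<lambda>p. \<Sum>m. u p * indicator (D m) (fst p))" "R u = R (\<lambda>p. \<Sum>m. u p * indicator (D m) (fst p))"
    by simp_all
  then have "L u = R u"
    unfolding L_suminf[OF H] R_suminf[OF H] on_piece[OF u] by simp
  then show ?thesis
    by (simp add: L_def R_def u_def)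
qed

text \<open>When finitely many points have been added, a point of the enlarged configuration is one of them
  or a point of the original one; almost surely it is not both.\<close>

lemma mecke_union:
  fixes H :: "'a \<Rightarrow> 'a set \<Rightarrow> ennreal"
  assumes H [measurable]: "(\<lambda>(x, \<omega>). H x \<omega>) \<in> borel_measurable (borel \<Otimes>\<^sub>M config_space)" and S: "finite S"
  shows "(\<integral>\<^sup>+\<omega>. (\<integral>\<^sup>+x. H x (\<omega> \<union> S) \<partial>config_measure (\<omega> \<union> S)) \<partial>P) =
    (\<integral>\<^sup>+x. (\<integral>\<^sup>+\<omega>. H x (insert x (\<omega> \<union> S)) \<partial>P) \<partial>\<sigma>) + (\<Sum>s\<in>S. \<integral>\<^sup>+\<omega>. H s (\<omega> \<union> S) \<partial>P)"
proof -
  have [measurable]: "(\<lambda>\<omega>. \<omega> \<union> S) \<in> measurable config_space config_space"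
    using measurable_union_config[of S "\<lambda>_ s. s" config_space "\<lambda>\<omega>. \<omega>"] S by simp
  have HS [measurable]: "(\<lambda>(x, \<omega>). H x (\<omega> \<union> S)) \<in> borel_measurable (borel \<Otimes>\<^sub>M config_space)"
    by measurable
  have HS2 [measurable]: "(\<lambda>\<omega>. H s (\<omega> \<union> S)) \<in> borel_measurable config_space" for s
    by measurable
  have "(\<integral>\<^sup>+\<omega>. (\<integral>\<^sup>+x. H x (\<omega> \<union> S) \<partial>config_measure (\<omega> \<union> S)) \<partial>P) =
      (\<integral>\<^sup>+\<omega>. (\<integral>\<^sup>+x. H x (\<omega> \<union> S) \<partial>config_measure \<omega>) + (\<Sum>s\<in>S. H s (\<omega> \<union> S)) \<partial>P)"
  proof (intro nn_integral_cong_AE)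
    show "AE \<omega> in P. (\<integral>\<^sup>+x. H x (\<omega> \<union> S) \<partial>config_measure (\<omega> \<union> S)) =
        (\<integral>\<^sup>+x. H x (\<omega> \<union> S) \<partial>config_measure \<omega>) + (\<Sum>s\<in>S. H s (\<omega> \<union> S))"
      using AE_finite_disjoint_config[OF S] AE_space
    proof eventually_elim
      case (elim \<omega>)
      then have "(\<lambda>x. H x (\<omega> \<union> S)) \<in> borel_measurable borel"
        using measurable_Pair1[OF HS, of \<omega>] by (simp add: space_P)
      then show ?case
        using S elim(1) by (rule nn_integral_config_measure_union)
    qed
  qed
  also have "\<dots> = (\<integral>\<^sup>+\<omega>. (\<integral>\<^sup>+x. H x (\<omega> \<union> S) \<partial>config_measure \<omega>) \<partial>P) + (\<integral>\<^sup>+\<omega>. (\<Sum>s\<in>S. H s (\<omega> \<union> S)) \<partial>P)"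
    using measurable_config_sections(2)[OF HS] by (intro nn_integral_add) auto
  also have "(\<integral>\<^sup>+\<omega>. (\<integral>\<^sup>+x. H x (\<omega> \<union> S) \<partial>config_measure \<omega>) \<partial>P) = (\<integral>\<^sup>+x. (\<integral>\<^sup>+\<omega>. H x (insert x (\<omega> \<union> S)) \<partial>P) \<partial>\<sigma>)"
    using mecke[OF HS] by simp
  also have "(\<integral>\<^sup>+\<omega>. (\<Sum>s\<in>S. H s (\<omega> \<union> S)) \<partial>P) = (\<Sum>s\<in>S. \<integral>\<^sup>+\<omega>. H s (\<omega> \<union> S) \<partial>P)"
    by (intro nn_integral_sum) measurable
  finally show ?thesis .
qed

sublocale sigma_product: product_sigma_finite "\<lambda>_ :: nat. \<sigma>" ..

text \<open>Fixing all coordinates but one, the remaining one has to avoid finitely many points, each of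
  which is a null set.\<close>

lemma AE_PiM_inj_on:
  fixes I :: "nat set"
  assumes I: "finite I"
  shows "AE y in PiM I (\<lambda>_. \<sigma>). inj_on y I"
proof -
  have "AE y in PiM I (\<lambda>_. \<sigma>). y i \<noteq> y j" if ij: "i \<in> I" "j \<in> I" "i \<noteq> j" for i j
  proof -
    define I' where "I' = I - {i}"
    have I': "finite I'" "i \<notin> I'" "j \<in> I'" "I = insert i I'"
      using ij I by (auto simp: I'_def)
    have [measurable]: "(\<lambda>y. y i) \<in> measurable (PiM I (\<lambda>_. \<sigma>)) borel" "(\<lambda>y. y j) \<in> measurable (PiM I (\<lambda>_. \<sigma>)) borel"
      using ij measurable_component_singleton[of _ I "\<lambda>_. \<sigma>"] by (auto cong: measurable_cong_sets simp: sets_\<sigma>)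
    define h :: "(nat \<Rightarrow> 'a) \<Rightarrow> ennreal" where "h y = (if y i = y j then 1 else 0)" for y
    have h [measurable]: "h \<in> borel_measurable (PiM I (\<lambda>_. \<sigma>))"
      unfolding h_def by measurable
    have "(\<integral>\<^sup>+y. h y \<partial>PiM I (\<lambda>_. \<sigma>)) = (\<integral>\<^sup>+y. (\<integral>\<^sup>+z. h (y(i := z)) \<partial>\<sigma>) \<partial>PiM I' (\<lambda>_. \<sigma>))"
      using h unfolding I'(4) by (intro sigma_product.product_nn_integral_insert I'(1,2)) auto
    also have "\<dots> = (\<integral>\<^sup>+y. emeasure \<sigma> {y j} \<partial>PiM I' (\<lambda>_. \<sigma>))"
    proof (intro nn_integral_cong)
      fix y
      have "(\<integral>\<^sup>+z. h (y(i := z)) \<partial>\<sigma>) = (\<integral>\<^sup>+z. indicator {y j} z \<partial>\<sigma>)"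
        using ij by (intro nn_integral_cong) (auto simp: h_def indicator_def)
      then show "(\<integral>\<^sup>+z. h (y(i := z)) \<partial>\<sigma>) = emeasure \<sigma> {y j}"
        by (simp add: sets_\<sigma>)
    qed
    also have "\<dots> = 0"
      by (simp add: \<sigma>_point)
    finally have "AE y in PiM I (\<lambda>_. \<sigma>). h y = 0"
      by (subst (asm) nn_integral_0_iff_AE) auto
    then show ?thesis
      by eventually_elim (auto simp: h_def split: if_splits)
  qed
  then have "AE y in PiM I (\<lambda>_. \<sigma>). \<forall>i\<in>I. \<forall>j\<in>I. i \<noteq> j \<longrightarrow> y i \<noteq> y j"
    using I by (intro AE_finite_allI) (auto intro: AE_impI)
  then show ?thesis
    by eventually_elim (auto simp: inj_on_def)
qed

end

section \<open>The moment formula indexed by retractions\<close>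

text \<open>A partition of \<open>{1..n}\<close> is the same as the map sending each point to the least element of its
  block. These maps are easier to handle in an induction on \<open>n\<close> than partitions: adding the point
  \<open>Suc n\<close> to an existing block leaves the values of the map, which index the integration variables,
  unchanged.\<close>

definition retractions :: "nat \<Rightarrow> (nat \<Rightarrow> nat) \<Rightarrow> (nat \<Rightarrow> nat) set" where
  "retractions n \<epsilon> = {r \<in> {1..n} \<rightarrow>\<^sub>E {1..n}.
     \<forall>i\<in>{1..n}. r i \<le> i \<and> r (r i) = r i \<and> (r i \<noteq> i \<longrightarrow> \<epsilon> i = 1 \<and> \<epsilon> (r i) = 1)}"

text \<open>The possible values at \<open>Suc n\<close>: a new block, or the least element of an existing block, where
  the condition \<open>\<epsilon> j = 1\<close> on the least element decides for the whole block.\<close>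

definition extension_values :: "nat \<Rightarrow> (nat \<Rightarrow> nat) \<Rightarrow> (nat \<Rightarrow> nat) \<Rightarrow> nat set" where
  "extension_values n \<epsilon> r =
     insert (Suc n) (if \<epsilon> (Suc n) = 1 then {j \<in> r ` {1..n}. \<epsilon> j = 1} else {})"

lemma finite_retractions: "finite (retractions n \<epsilon>)"
  by (rule finite_subset[of _ "{1..n} \<rightarrow>\<^sub>E {1..n}"]) (auto simp: retractions_def intro: finite_PiE)

lemma retractions_0: "retractions 0 \<epsilon> = {\<lambda>_. undefined}"
  by (auto simp: retractions_def)

lemma retraction_range:
  assumes "r \<in> retractions n \<epsilon>"
  shows "r ` {1..n} \<subseteq> {1..n}" and "Suc n \<notin> r ` {1..n}" and "j \<in> r ` {1..n} \<Longrightarrow> r j = j"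
proof -
  have r: "r i \<in> {1..n}" "r (r i) = r i" if "i \<in> {1..n}" for i
    using assms that by (auto simp: retractions_def)
  then show "r ` {1..n} \<subseteq> {1..n}"
    by blast
  then show "Suc n \<notin> r ` {1..n}"
    by (metis atLeastAtMost_iff not_less_eq_eq order_refl subsetD)
  show "r j = j" if "j \<in> r ` {1..n}"
    using that r(2) by blast
qed

text \<open>Restricting a retraction to \<open>{1..n}\<close> and recording its value at \<open>Suc n\<close> loses nothing: this is
  the recursion of admissible partitions on which the induction rests.\<close>

lemma bij_betw_extend_retraction:
  "bij_betw (\<lambda>(r, j). r(Suc n := j)) (Sigma (retractions n \<epsilon>) (extension_values n \<epsilon>)) (retractions (Suc n) \<epsilon>)"
proof (rule bij_betwI[where g="\<lambda>r. (restrict r {1..n}, r (Suc n))"])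
  show "(\<lambda>(r, j). r(Suc n := j)) \<in> Sigma (retractions n \<epsilon>) (extension_values n \<epsilon>) \<rightarrow> retractions (Suc n) \<epsilon>"
  proof clarify
    fix r j assume r: "r \<in> retractions n \<epsilon>" and j: "j \<in> extension_values n \<epsilon> r"
    have r_less: "r i \<in> {1..n}" "r i \<noteq> Suc n" if "i \<in> {1..n}" for i
      using retraction_range(1)[OF r] that by fastforce+
    have j': "j = Suc n \<or> (j \<in> {1..n} \<and> j \<noteq> Suc n \<and> r j = j \<and> \<epsilon> (Suc n) = 1 \<and> \<epsilon> j = 1)"
    proof (cases "j = Suc n")
      case False
      then have "j \<in> r ` {1..n}" "\<epsilon> (Suc n) = 1" "\<epsilon> j = 1"
        using j by (auto simp: extension_values_def split: if_splits)
      moreover have "j \<in> {1..n}" "j \<noteq> Suc n" "r j = j"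
        using \<open>j \<in> r ` {1..n}\<close> retraction_range(1,2)[OF r] retraction_range(3)[OF r, of j] by blast+
      ultimately show ?thesis
        by simp
    qed simp
    have "(r(Suc n := j)) i \<in> {1..Suc n}" if "i \<in> {1..Suc n}" for i
    proof (cases "i = Suc n")
      case True
      then show ?thesis
        using j' by (elim disjE) simp_all
    next
      case False
      then have "i \<in> {1..n}"
        using that by simp
      from r_less(1)[OF this] False show ?thesis
        by simp
    qed
    moreover have "(r(Suc n := j)) i = undefined" if "i \<notin> {1..Suc n}" for i
      using that r by (auto simp: retractions_def PiE_def extensional_def)
    moreover have "(r(Suc n := j)) i \<le> i \<and> (r(Suc n := j)) ((r(Suc n := j)) i) = (r(Suc n := j)) i \<and>
        ((r(Suc n := j)) i \<noteq> i \<longrightarrow> \<epsilon> i = 1 \<and> \<epsilon> ((r(Suc n := j)) i) = 1)" if "i \<in> {1..Suc n}" for i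
    proof (cases "i = Suc n")
      case True
      then show ?thesis
        using j' by auto
    next
      case False
      then have "i \<in> {1..n}"
        using that by auto
      with r_less(2)[of i] r show ?thesis
        by (auto simp: retractions_def)
    qed
    ultimately show "r(Suc n := j) \<in> retractions (Suc n) \<epsilon>"
      by (auto simp: retractions_def PiE_def extensional_def)
  qed
  show "(\<lambda>r. (restrict r {1..n}, r (Suc n))) \<in> retractions (Suc n) \<epsilon> \<rightarrow> Sigma (retractions n \<epsilon>) (extension_values n \<epsilon>)"
  proof (intro funcsetI SigmaI)
    fix r assume r: "r \<in> retractions (Suc n) \<epsilon>"
    have r_props: "r i \<in> {1..Suc n}" "r i \<le> i" "r (r i) = r i" "r i \<noteq> i \<Longrightarrow> \<epsilon> i = 1 \<and> \<epsilon> (r i) = 1"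
      if "i \<in> {1..Suc n}" for i
      using r that by (auto simp: retractions_def)
    have r_n: "r i \<in> {1..n}" if "i \<in> {1..n}" for i
      using r_props(1,2)[of i] that by auto
    then show "restrict r {1..n} \<in> retractions n \<epsilon>"
      using r_props(2-4) by (auto simp: retractions_def)
    show "r (Suc n) \<in> extension_values n \<epsilon> (restrict r {1..n})"
    proof (cases "r (Suc n) = Suc n")
      case False
      then have "r (Suc n) \<in> {1..n}"
        using r_props(1)[of "Suc n"] by auto
      moreover have "r (r (Suc n)) = r (Suc n)" "\<epsilon> (Suc n) = 1" "\<epsilon> (r (Suc n)) = 1"
        using r_props[of "Suc n"] False by auto
      ultimately show ?thesis
        by (auto simp: extension_values_def intro!: image_eqI[of _ _ "r (Suc n)"])
    qed (simp add: extension_values_def)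
  qed
  show "(\<lambda>r. (restrict r {1..n}, r (Suc n))) ((\<lambda>(r, j). r(Suc n := j)) p) = p"
    if "p \<in> Sigma (retractions n \<epsilon>) (extension_values n \<epsilon>)" for p
  proof -
    have "fst p \<in> extensional {1..n}"
      using that by (auto simp: retractions_def PiE_def)
    then have "restrict ((fst p)(Suc n := snd p)) {1..n} = fst p"
      by (auto simp: fun_eq_iff extensional_def)
    then show ?thesis
      by (simp add: case_prod_beta)
  qed
  show "(case (restrict r {1..n}, r (Suc n)) of (r, j) \<Rightarrow> r(Suc n := j)) = r"
    if "r \<in> retractions (Suc n) \<epsilon>" for r
    using that by (auto simp: retractions_def PiE_def extensional_def fun_eq_iff)
qed

lemma image_extend_retraction:
  assumes "r \<in> retractions n \<epsilon>" "j \<in> extension_values n \<epsilon> r"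
  shows "(r(Suc n := j)) ` {1..Suc n} = (if j = Suc n then insert (Suc n) (r ` {1..n}) else r ` {1..n})"
proof -
  have *: "{1..Suc n} = insert (Suc n) {1..n}"
    by auto
  have "(r(Suc n := j)) ` {1..n} = r ` {1..n}"
    by (intro image_cong) auto
  then have "(r(Suc n := j)) ` {1..Suc n} = insert j (r ` {1..n})"
    unfolding * image_insert by (simp only: fun_upd_same)
  then show ?thesis
    using assms(2) by (auto simp: extension_values_def split: if_splits)
qed

lemma measurable_process_update:
  fixes F :: "(nat \<Rightarrow> 'a::topological_space) \<Rightarrow> 'a set \<Rightarrow> ennreal"
  assumes F: "(\<lambda>(x, \<omega>). F x \<omega>) \<in> borel_measurable (PiM {1..Suc n} (\<lambda>_. borel) \<Otimes>\<^sub>M config_space)"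
    and p: "p \<in> measurable N (PiM {1..n} (\<lambda>_. borel))" and z: "z \<in> measurable N borel"
    and h: "h \<in> measurable N config_space"
  shows "(\<lambda>w. F ((p w)(Suc n := z w)) (h w)) \<in> borel_measurable N"
proof -
  have "(\<lambda>w. (p w)(Suc n := z w)) \<in> measurable N (PiM {1..Suc n} (\<lambda>_. borel))"
    by (rule measurable_fun_upd[OF _ p z]) auto
  from measurable_compose[OF measurable_Pair[OF this h] F] show ?thesis
    by simp
qed

context diffuse_poisson
begin

text \<open>There is one integration variable per block, indexed by the least element of the block, that is,
  by the range of \<open>r\<close>. The tuple \<open>block_point r n y\<close> repeats the variable of a block at all positions
  of the block.\<close>

definition block_point :: "(nat \<Rightarrow> nat) \<Rightarrow> nat \<Rightarrow> (nat \<Rightarrow> 'a) \<Rightarrow> nat \<Rightarrow> 'a" where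
  "block_point r n y = (\<lambda>i\<in>{1..n}. y (r i))"

definition retraction_moment ::
    "nat \<Rightarrow> (nat \<Rightarrow> nat) \<Rightarrow> (nat \<Rightarrow> nat) \<Rightarrow> ((nat \<Rightarrow> 'a) \<Rightarrow> 'a set \<Rightarrow> ennreal) \<Rightarrow> ennreal" where
  "retraction_moment n \<epsilon> r F =
     (\<integral>\<^sup>+y. (\<integral>\<^sup>+\<omega>. F (block_point r n y) (\<omega> \<union> y ` {j \<in> r ` {1..n}. \<epsilon> j = 1}) \<partial>P) \<partial>PiM (r ` {1..n}) (\<lambda>_. \<sigma>))"

lemma sigma_finite_choose_measure:
  "\<omega> \<in> configurations \<Longrightarrow> product_sigma_finite (\<lambda>i. choose_measure \<sigma> \<omega> (\<epsilon> i))"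
  by (auto simp: product_sigma_finite_def choose_measure_def sigma_finite_config_measure sigma.sigma_finite_measure_axioms)

lemma sets_choose_measure: "sets (choose_measure \<sigma> \<omega> e) = sets borel"
  by (simp add: choose_measure_def sets_\<sigma>)

lemma sets_PiM_\<sigma> [measurable_cong]: "sets (PiM I (\<lambda>_. \<sigma>)) = sets (PiM I (\<lambda>_. borel))"
  by (intro sets_PiM_cong refl sets_\<sigma>)

lemma measurable_PiM_\<sigma>_component: "i \<in> I \<Longrightarrow> (\<lambda>y. y i) \<in> measurable (PiM I (\<lambda>_. \<sigma>)) borel"
  using measurable_component_singleton[of i I "\<lambda>_. borel"] by measurable

lemma measurable_block_point:
  assumes "r ` {1..n} \<subseteq> I"
  shows "block_point r n \<in> measurable (PiM I (\<lambda>_. \<sigma>)) (PiM {1..n} (\<lambda>_. borel))"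
  unfolding block_point_def[abs_def]
  by (intro measurable_restrict measurable_PiM_\<sigma>_component) (use assms in auto)

text \<open>Integrating out the last coordinate against \<open>\<sigma>\<close> adds a singleton block. Integrating it
  against \<open>\<omega>\<close>, seen from a configuration that already contains the points of the marked blocks,
  either picks one of these points, or, by the Mecke formula, a new point.\<close>

lemma retraction_moment_extend:
  fixes F :: "(nat \<Rightarrow> 'a) \<Rightarrow> 'a set \<Rightarrow> ennreal"
  assumes F: "(\<lambda>(x, \<omega>). F x \<omega>) \<in> borel_measurable (PiM {1..Suc n} (\<lambda>_. borel) \<Otimes>\<^sub>M config_space)"
    and r: "r \<in> retractions n \<epsilon>"
  shows "retraction_moment n \<epsilon> r (\<lambda>x \<omega>. \<integral>\<^sup>+z. F (x(Suc n := z)) \<omega> \<partial>choose_measure \<sigma> \<omega> (\<epsilon> (Suc n))) =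
    (\<Sum>j\<in>extension_values n \<epsilon> r. retraction_moment (Suc n) \<epsilon> (r(Suc n := j)) F)"
proof -
  define I where "I = r ` {1..n}"
  define J where "J = {j \<in> I. \<epsilon> j = 1}"
  define \<pi> where "\<pi> = block_point r n"
  have I: "finite I" "Suc n \<notin> I" "finite J" "J \<subseteq> I"
    using retraction_range(2)[OF r] unfolding I_def J_def by auto
  have \<pi>_meas [measurable]: "\<pi> \<in> measurable (PiM I (\<lambda>_. \<sigma>)) (PiM {1..n} (\<lambda>_. borel))"
    unfolding \<pi>_def by (rule measurable_block_point) (simp add: I_def)
  have \<pi>_space: "\<pi> y \<in> space (PiM {1..n} (\<lambda>_. borel))" for y
    by (simp add: \<pi>_def block_point_def space_PiM)
  have union_meas: "(\<lambda>w. h w \<union> y w ` J) \<in> measurable N config_space"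
    if y: "y \<in> measurable N (PiM I (\<lambda>_. \<sigma>))" and "h \<in> measurable N config_space"
    for y :: "'c \<Rightarrow> nat \<Rightarrow> 'a" and h and N
  proof (rule measurable_union_config)
    fix j assume "j \<in> J"
    then show "(\<lambda>w. y w j) \<in> measurable N borel"
      using measurable_compose[OF y measurable_PiM_\<sigma>_component[of j I]] I by auto
  qed (use I that in auto)
  have block_upd: "block_point (r(Suc n := j)) (Suc n) y = (\<pi> y)(Suc n := y j)" for j y
    by (auto simp: \<pi>_def block_point_def fun_eq_iff)

  \<comment> \<open>\<open>old\<close>: the point \<open>Suc n\<close> joins the block of \<open>j\<close>; \<open>new\<close>: it forms a block of its own, so one
    integration variable is added.\<close>
  have old: "retraction_moment (Suc n) \<epsilon> (r(Suc n := j)) F =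
      (\<integral>\<^sup>+y. (\<integral>\<^sup>+\<omega>. F ((\<pi> y)(Suc n := y j)) (\<omega> \<union> y ` J) \<partial>P) \<partial>PiM I (\<lambda>_. \<sigma>))"
    if "j \<in> J" "\<epsilon> (Suc n) = 1" for j
  proof -
    have "j \<in> extension_values n \<epsilon> r"
      using that by (simp add: extension_values_def J_def I_def)
    moreover have "j \<noteq> Suc n"
      using that(1) I(2,4) by blast
    ultimately have j: "j \<in> extension_values n \<epsilon> r" "j \<noteq> Suc n" .
    have "(r(Suc n := j)) ` {1..Suc n} = I"
      using image_extend_retraction[OF r j(1)] j(2) by (simp add: I_def)
    then show ?thesis
      unfolding retraction_moment_def block_upd J_def by simp
  qed
  have new: "retraction_moment (Suc n) \<epsilon> (r(Suc n := Suc n)) F =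
      (\<integral>\<^sup>+y. (\<integral>\<^sup>+z. (\<integral>\<^sup>+\<omega>. F ((\<pi> y)(Suc n := z))
        (if \<epsilon> (Suc n) = 1 then insert z (\<omega> \<union> y ` J) else \<omega> \<union> y ` J) \<partial>P) \<partial>\<sigma>) \<partial>PiM I (\<lambda>_. \<sigma>))"
  proof -
    define J' where "J' = {j \<in> insert (Suc n) I. \<epsilon> j = 1}"
    have J'_eq: "J' = (if \<epsilon> (Suc n) = 1 then insert (Suc n) J else J)"
      by (auto simp: J'_def J_def)
    have "(r(Suc n := Suc n)) ` {1..Suc n} = insert (Suc n) I"
      using image_extend_retraction[OF r, of "Suc n"] by (simp add: I_def extension_values_def)
    then have "retraction_moment (Suc n) \<epsilon> (r(Suc n := Suc n)) F =
        (\<integral>\<^sup>+y. (\<integral>\<^sup>+\<omega>. F ((\<pi> y)(Suc n := y (Suc n))) (\<omega> \<union> y ` J') \<partial>P) \<partial>PiM (insert (Suc n) I) (\<lambda>_. \<sigma>))"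
      unfolding retraction_moment_def block_upd J'_def by simp
    also have "\<dots> = (\<integral>\<^sup>+y. (\<integral>\<^sup>+z. (\<integral>\<^sup>+\<omega>. F ((\<pi> (y(Suc n := z)))(Suc n := (y(Suc n := z)) (Suc n)))
        (\<omega> \<union> (y(Suc n := z)) ` J') \<partial>P) \<partial>\<sigma>) \<partial>PiM I (\<lambda>_. \<sigma>))"
    proof (rule sigma_product.product_nn_integral_insert[OF I(1,2)])
      let ?N = "PiM (insert (Suc n) I) (\<lambda>_. \<sigma>) \<Otimes>\<^sub>M P"
      have comp: "(\<lambda>w. fst w j) \<in> measurable ?N borel" if "j \<in> insert (Suc n) I" for j
        by (rule measurable_compose[OF measurable_fst measurable_PiM_\<sigma>_component[OF that]])
      have "(\<lambda>w. F ((\<pi> (fst w))(Suc n := fst w (Suc n))) (snd w \<union> fst w ` J')) \<in> borel_measurable ?N"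
      proof (rule measurable_process_update[OF F])
        have "\<pi> \<in> measurable (PiM (insert (Suc n) I) (\<lambda>_. \<sigma>)) (PiM {1..n} (\<lambda>_. borel))"
          unfolding \<pi>_def by (rule measurable_block_point) (auto simp: I_def)
        then show "(\<lambda>w. \<pi> (fst w)) \<in> measurable ?N (PiM {1..n} (\<lambda>_. borel))"
          by (rule measurable_compose[OF measurable_fst])
        show "(\<lambda>w. snd w \<union> fst w ` J') \<in> measurable ?N config_space"
        proof (rule measurable_union_config)
          show "finite J'"
            using I(1) by (simp add: J'_def)
          show "(\<lambda>w. fst w j) \<in> measurable ?N borel" if "j \<in> J'" for j
            using that by (intro comp) (auto simp: J'_def)
          show "snd \<in> measurable ?N config_space"
            by measurable
        qed
      qed (rule comp, simp)
      then show "(\<lambda>y. \<integral>\<^sup>+\<omega>. F ((\<pi> y)(Suc n := y (Suc n))) (\<omega> \<union> y ` J') \<partial>P)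
          \<in> borel_measurable (PiM (insert (Suc n) I) (\<lambda>_. \<sigma>))"
        by (intro borel_measurable_nn_integral) (simp add: case_prod_beta')
    qed
    also have "\<dots> = (\<integral>\<^sup>+y. (\<integral>\<^sup>+z. (\<integral>\<^sup>+\<omega>. F ((\<pi> y)(Suc n := z))
        (if \<epsilon> (Suc n) = 1 then insert z (\<omega> \<union> y ` J) else \<omega> \<union> y ` J) \<partial>P) \<partial>\<sigma>) \<partial>PiM I (\<lambda>_. \<sigma>))"
    proof (intro nn_integral_cong arg_cong2[where f=F])
      fix y z and \<omega> :: "'a set"
      have "r i \<noteq> Suc n" if "i \<in> {1..n}" for i
        using I(2) that unfolding I_def by (metis imageI)
      then have "\<pi> (y(Suc n := z)) = \<pi> y"
        by (simp add: \<pi>_def block_point_def fun_eq_iff)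
      then show "(\<pi> (y(Suc n := z)))(Suc n := (y(Suc n := z)) (Suc n)) = (\<pi> y)(Suc n := z)"
        by simp
      have "(y(Suc n := z)) ` J = y ` J" "(y(Suc n := z)) (Suc n) = z"
        using I by (auto intro!: image_cong simp del: fun_upd_image)
      then show "\<omega> \<union> (y(Suc n := z)) ` J' = (if \<epsilon> (Suc n) = 1 then insert z (\<omega> \<union> y ` J) else \<omega> \<union> y ` J)"
        by (simp add: J'_eq del: fun_upd_apply)
    qed
    finally show ?thesis .
  qed

  show ?thesis
  proof (cases "\<epsilon> (Suc n) = 1")
    case False
    have "retraction_moment n \<epsilon> r (\<lambda>x \<omega>. \<integral>\<^sup>+z. F (x(Suc n := z)) \<omega> \<partial>choose_measure \<sigma> \<omega> (\<epsilon> (Suc n))) =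
        (\<integral>\<^sup>+y. (\<integral>\<^sup>+\<omega>. (\<integral>\<^sup>+z. F ((\<pi> y)(Suc n := z)) (\<omega> \<union> y ` J) \<partial>\<sigma>) \<partial>P) \<partial>PiM I (\<lambda>_. \<sigma>))"
      using False by (simp add: retraction_moment_def choose_measure_def I_def J_def \<pi>_def)
    also have "\<dots> = (\<integral>\<^sup>+y. (\<integral>\<^sup>+z. (\<integral>\<^sup>+\<omega>. F ((\<pi> y)(Suc n := z)) (\<omega> \<union> y ` J) \<partial>P) \<partial>\<sigma>) \<partial>PiM I (\<lambda>_. \<sigma>))"
    proof (intro nn_integral_cong sigma_P.Fubini')
      fix y assume "y \<in> space (PiM I (\<lambda>_. \<sigma>))"
      then have "(\<lambda>w. F ((\<pi> y)(Suc n := fst w)) (snd w \<union> y ` J)) \<in> borel_measurable (\<sigma> \<Otimes>\<^sub>M P)"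
        using \<pi>_space by (intro measurable_process_update[OF F] union_meas measurable_const) measurable
      then show "(\<lambda>(z, \<omega>). F ((\<pi> y)(Suc n := z)) (\<omega> \<union> y ` J)) \<in> borel_measurable (\<sigma> \<Otimes>\<^sub>M P)"
        by (simp add: case_prod_beta')
    qed
    also have "\<dots> = retraction_moment (Suc n) \<epsilon> (r(Suc n := Suc n)) F"
      using False by (simp add: new)
    finally show ?thesis
      using False by (simp add: extension_values_def)
  next
    case True
    have update_meas: "(\<lambda>w. F ((\<pi> (y w))(Suc n := z w)) (h w)) \<in> borel_measurable N"
      if "y \<in> measurable N (PiM I (\<lambda>_. \<sigma>))" "z \<in> measurable N borel" "h \<in> measurable N config_space"
      for y :: "'c \<Rightarrow> nat \<Rightarrow> 'a" and z h N
      using that measurable_compose[OF that(1) \<pi>_meas] by (intro measurable_process_update[OF F])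
    have new_meas: "(\<lambda>y. \<integral>\<^sup>+z. (\<integral>\<^sup>+\<omega>. F ((\<pi> y)(Suc n := z)) (insert z (\<omega> \<union> y ` J)) \<partial>P) \<partial>\<sigma>)
        \<in> borel_measurable (PiM I (\<lambda>_. \<sigma>))"
    proof -
      let ?N = "(PiM I (\<lambda>_. \<sigma>) \<Otimes>\<^sub>M \<sigma>) \<Otimes>\<^sub>M P"
      have "(\<lambda>w. F ((\<pi> (fst (fst w)))(Suc n := snd (fst w))) (insert (snd (fst w)) (snd w \<union> fst (fst w) ` J)))
          \<in> borel_measurable ?N"
        by (intro update_meas measurable_insert_config' union_meas) measurable
      then show ?thesis
        by (intro sigma.borel_measurable_nn_integral borel_measurable_nn_integral[of _ "PiM I (\<lambda>_. \<sigma>) \<Otimes>\<^sub>M \<sigma>"])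
          (simp add: case_prod_beta')
    qed
    have old_meas: "(\<lambda>y. \<integral>\<^sup>+\<omega>. F ((\<pi> y)(Suc n := y j)) (\<omega> \<union> y ` J) \<partial>P) \<in> borel_measurable (PiM I (\<lambda>_. \<sigma>))"
      if "j \<in> J" for j
    proof -
      let ?N = "PiM I (\<lambda>_. \<sigma>) \<Otimes>\<^sub>M P"
      have "(\<lambda>w. fst w j) \<in> measurable ?N borel"
        using that I(4) by (intro measurable_compose[OF measurable_fst measurable_PiM_\<sigma>_component]) auto
      moreover have "snd \<in> measurable ?N config_space"
        by measurable
      ultimately have "(\<lambda>w. F ((\<pi> (fst w))(Suc n := fst w j)) (snd w \<union> fst w ` J)) \<in> borel_measurable ?N"
        by (intro update_meas[OF measurable_fst] union_meas[OF measurable_fst])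
      then show ?thesis
        by (intro borel_measurable_nn_integral) (simp add: case_prod_beta')
    qed
    have "retraction_moment n \<epsilon> r (\<lambda>x \<omega>. \<integral>\<^sup>+z. F (x(Suc n := z)) \<omega> \<partial>choose_measure \<sigma> \<omega> (\<epsilon> (Suc n))) =
        (\<integral>\<^sup>+y. (\<integral>\<^sup>+\<omega>. (\<integral>\<^sup>+z. F ((\<pi> y)(Suc n := z)) (\<omega> \<union> y ` J) \<partial>config_measure (\<omega> \<union> y ` J)) \<partial>P) \<partial>PiM I (\<lambda>_. \<sigma>))"
      using True by (simp add: retraction_moment_def choose_measure_def I_def J_def \<pi>_def)
    also have "\<dots> = (\<integral>\<^sup>+y. (\<integral>\<^sup>+z. (\<integral>\<^sup>+\<omega>. F ((\<pi> y)(Suc n := z)) (insert z (\<omega> \<union> y ` J)) \<partial>P) \<partial>\<sigma>) +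
        (\<Sum>j\<in>J. \<integral>\<^sup>+\<omega>. F ((\<pi> y)(Suc n := y j)) (\<omega> \<union> y ` J) \<partial>P) \<partial>PiM I (\<lambda>_. \<sigma>))"
    proof (rule nn_integral_cong_AE)
      show "AE y in PiM I (\<lambda>_. \<sigma>).
        (\<integral>\<^sup>+\<omega>. (\<integral>\<^sup>+z. F ((\<pi> y)(Suc n := z)) (\<omega> \<union> y ` J) \<partial>config_measure (\<omega> \<union> y ` J)) \<partial>P) =
        (\<integral>\<^sup>+z. (\<integral>\<^sup>+\<omega>. F ((\<pi> y)(Suc n := z)) (insert z (\<omega> \<union> y ` J)) \<partial>P) \<partial>\<sigma>) +
        (\<Sum>j\<in>J. \<integral>\<^sup>+\<omega>. F ((\<pi> y)(Suc n := y j)) (\<omega> \<union> y ` J) \<partial>P)"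
        using AE_PiM_inj_on[OF I(1)] AE_space
      proof eventually_elim
        case (elim y)
        have "(\<lambda>w. F ((\<pi> y)(Suc n := fst w)) (snd w)) \<in> borel_measurable (borel \<Otimes>\<^sub>M config_space)"
          using \<pi>_space by (intro measurable_process_update[OF F] measurable_const) measurable
        then have "(\<integral>\<^sup>+\<omega>. (\<integral>\<^sup>+z. F ((\<pi> y)(Suc n := z)) (\<omega> \<union> y ` J) \<partial>config_measure (\<omega> \<union> y ` J)) \<partial>P) =
            (\<integral>\<^sup>+z. (\<integral>\<^sup>+\<omega>. F ((\<pi> y)(Suc n := z)) (insert z (\<omega> \<union> y ` J)) \<partial>P) \<partial>\<sigma>) +
            (\<Sum>s\<in>y ` J. \<integral>\<^sup>+\<omega>. F ((\<pi> y)(Suc n := s)) (\<omega> \<union> y ` J) \<partial>P)"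
          using I(3) by (intro mecke_union) (simp_all add: case_prod_beta' del: fun_upd_apply)
        moreover have "inj_on y J"
          using elim(1) I(4) by (rule inj_on_subset)
        ultimately show ?case
          by (simp add: sum.reindex)
      qed
    qed
    also have "\<dots> = (\<integral>\<^sup>+y. (\<integral>\<^sup>+z. (\<integral>\<^sup>+\<omega>. F ((\<pi> y)(Suc n := z)) (insert z (\<omega> \<union> y ` J)) \<partial>P) \<partial>\<sigma>) \<partial>PiM I (\<lambda>_. \<sigma>)) +
        (\<integral>\<^sup>+y. (\<Sum>j\<in>J. \<integral>\<^sup>+\<omega>. F ((\<pi> y)(Suc n := y j)) (\<omega> \<union> y ` J) \<partial>P) \<partial>PiM I (\<lambda>_. \<sigma>))"
      using new_meas old_meas by (intro nn_integral_add borel_measurable_sum)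
    also have "(\<integral>\<^sup>+y. (\<Sum>j\<in>J. \<integral>\<^sup>+\<omega>. F ((\<pi> y)(Suc n := y j)) (\<omega> \<union> y ` J) \<partial>P) \<partial>PiM I (\<lambda>_. \<sigma>)) =
        (\<Sum>j\<in>J. \<integral>\<^sup>+y. (\<integral>\<^sup>+\<omega>. F ((\<pi> y)(Suc n := y j)) (\<omega> \<union> y ` J) \<partial>P) \<partial>PiM I (\<lambda>_. \<sigma>))"
      using old_meas by (rule nn_integral_sum)
    finally have "retraction_moment n \<epsilon> r (\<lambda>x \<omega>. \<integral>\<^sup>+z. F (x(Suc n := z)) \<omega> \<partial>choose_measure \<sigma> \<omega> (\<epsilon> (Suc n))) =
        retraction_moment (Suc n) \<epsilon> (r(Suc n := Suc n)) F +
        (\<Sum>j\<in>J. retraction_moment (Suc n) \<epsilon> (r(Suc n := j)) F)"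
      using True by (simp add: new old del: fun_upd_apply)
    moreover have "extension_values n \<epsilon> r = insert (Suc n) J"
      using True by (simp add: extension_values_def J_def I_def)
    moreover have "Suc n \<notin> J"
      using I by auto
    ultimately show ?thesis
      using I(3) by simp
  qed
qed

text \<open>Induction on \<open>n\<close>: the integral over the last coordinate is itself a process in the remaining
  ones, to which the induction hypothesis applies; \<open>retraction_moment_extend\<close> then evaluates each term.\<close>

theorem moment_formula_retractions:
  fixes F :: "(nat \<Rightarrow> 'a) \<Rightarrow> 'a set \<Rightarrow> ennreal"
  assumes "(\<lambda>(x, \<omega>). F x \<omega>) \<in> borel_measurable (PiM {1..n} (\<lambda>_. borel) \<Otimes>\<^sub>M config_space)"
  shows "(\<integral>\<^sup>+\<omega>. (\<integral>\<^sup>+x. F x \<omega> \<partial>PiM {1..n} (\<lambda>i. choose_measure \<sigma> \<omega> (\<epsilon> i))) \<partial>P) =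
    (\<Sum>r\<in>retractions n \<epsilon>. retraction_moment n \<epsilon> r F)"
  using assms
proof (induction n arbitrary: F)
  case 0
  show ?case
    by (simp add: retractions_0 retraction_moment_def block_point_def PiM_empty
        nn_integral_count_space_finite restrict_def)
next
  case (Suc n)
  define G where "G x \<omega> = (\<integral>\<^sup>+z. F (x(Suc n := z)) \<omega> \<partial>choose_measure \<sigma> \<omega> (\<epsilon> (Suc n)))" for x \<omega>
  have interval: "{1..Suc n} = insert (Suc n) {1..n}"
    by auto
  have update: "(\<lambda>w. F ((fst (fst w))(Suc n := snd w)) (snd (fst w))) \<in>
      borel_measurable ((PiM {1..n} (\<lambda>_. borel) \<Otimes>\<^sub>M config_space) \<Otimes>\<^sub>M borel)"
    by (intro measurable_process_update[OF Suc.prems]) measurable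
  have G: "(\<lambda>(x, \<omega>). G x \<omega>) \<in> borel_measurable (PiM {1..n} (\<lambda>_. borel) \<Otimes>\<^sub>M config_space)"
  proof (cases "\<epsilon> (Suc n) = 1")
    case True
    have "(\<lambda>w. \<integral>\<^sup>+z. F ((fst w)(Suc n := z)) (snd w) \<partial>config_measure (snd w))
        \<in> borel_measurable (PiM {1..n} (\<lambda>_. borel) \<Otimes>\<^sub>M config_space)"
      using update by (intro measurable_nn_integral_config) (simp_all add: case_prod_beta' del: fun_upd_apply)
    then show ?thesis
      using True by (simp add: G_def choose_measure_def case_prod_beta' del: fun_upd_apply)
  next
    case False
    have "(\<lambda>w. \<integral>\<^sup>+z. F ((fst w)(Suc n := z)) (snd w) \<partial>\<sigma>)
        \<in> borel_measurable (PiM {1..n} (\<lambda>_. borel) \<Otimes>\<^sub>M config_space)"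
    proof (rule sigma.borel_measurable_nn_integral)
      have sets_eq: "sets ((PiM {1..n} (\<lambda>_. borel) \<Otimes>\<^sub>M config_space) \<Otimes>\<^sub>M \<sigma>) =
          sets ((PiM {1..n} (\<lambda>_. borel) \<Otimes>\<^sub>M config_space) \<Otimes>\<^sub>M (borel :: 'a measure))"
        by (intro sets_pair_measure_cong refl sets_\<sigma>)
      show "(\<lambda>(w, z). F ((fst w)(Suc n := z)) (snd w)) \<in>
          borel_measurable ((PiM {1..n} (\<lambda>_. borel) \<Otimes>\<^sub>M config_space) \<Otimes>\<^sub>M \<sigma>)"
        unfolding case_prod_beta' measurable_cong_sets[OF sets_eq refl] by (rule update)
    qed
    then show ?thesis
      using False by (simp add: G_def choose_measure_def case_prod_beta' del: fun_upd_apply)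
  qed
  have "(\<integral>\<^sup>+\<omega>. (\<integral>\<^sup>+x. F x \<omega> \<partial>PiM {1..Suc n} (\<lambda>i. choose_measure \<sigma> \<omega> (\<epsilon> i))) \<partial>P) =
      (\<integral>\<^sup>+\<omega>. (\<integral>\<^sup>+x. G x \<omega> \<partial>PiM {1..n} (\<lambda>i. choose_measure \<sigma> \<omega> (\<epsilon> i))) \<partial>P)"
  proof (intro nn_integral_cong)
    fix \<omega> assume "\<omega> \<in> space P"
    then have \<omega>: "\<omega> \<in> configurations"
      by (simp add: space_P)
    interpret c: product_sigma_finite "\<lambda>i. choose_measure \<sigma> \<omega> (\<epsilon> i)"
      using \<omega> by (rule sigma_finite_choose_measure)
    have "(\<lambda>x. F x \<omega>) \<in> borel_measurable (PiM {1..Suc n} (\<lambda>_. borel))"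
      using measurable_Pair1[OF Suc.prems, of \<omega>] \<omega> by simp
    moreover have sets_eq: "sets (PiM {1..Suc n} (\<lambda>i. choose_measure \<sigma> \<omega> (\<epsilon> i))) = sets (PiM {1..Suc n} (\<lambda>_. borel))"
      by (intro sets_PiM_cong refl sets_choose_measure)
    ultimately have "(\<lambda>x. F x \<omega>) \<in> borel_measurable (PiM {1..Suc n} (\<lambda>i. choose_measure \<sigma> \<omega> (\<epsilon> i)))"
      unfolding measurable_cong_sets[OF sets_eq refl] by simp
    then show "(\<integral>\<^sup>+x. F x \<omega> \<partial>PiM {1..Suc n} (\<lambda>i. choose_measure \<sigma> \<omega> (\<epsilon> i))) =
        (\<integral>\<^sup>+x. G x \<omega> \<partial>PiM {1..n} (\<lambda>i. choose_measure \<sigma> \<omega> (\<epsilon> i)))"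
      unfolding interval G_def by (intro c.product_nn_integral_insert) auto
  qed
  also have "\<dots> = (\<Sum>r\<in>retractions n \<epsilon>. retraction_moment n \<epsilon> r G)"
    by (rule Suc.IH[OF G])
  also have "\<dots> = (\<Sum>r\<in>retractions n \<epsilon>. \<Sum>j\<in>extension_values n \<epsilon> r. retraction_moment (Suc n) \<epsilon> (r(Suc n := j)) F)"
    unfolding G_def[abs_def] using Suc.prems by (intro sum.cong refl retraction_moment_extend)
  also have "\<dots> = (\<Sum>(r, j)\<in>Sigma (retractions n \<epsilon>) (extension_values n \<epsilon>). retraction_moment (Suc n) \<epsilon> (r(Suc n := j)) F)"
    by (rule sum.Sigma) (auto simp: finite_retractions extension_values_def)
  also have "\<dots> = (\<Sum>r\<in>retractions (Suc n) \<epsilon>. retraction_moment (Suc n) \<epsilon> r F)"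
    using sum.reindex_bij_betw[OF bij_betw_extend_retraction, of "\<lambda>r. retraction_moment (Suc n) \<epsilon> r F"]
    by (simp add: case_prod_beta')
  finally show ?case .
qed

end

section \<open>From retractions to partitions\<close>

definition fibre :: "nat \<Rightarrow> (nat \<Rightarrow> nat) \<Rightarrow> nat \<Rightarrow> nat set" where
  "fibre n r j = {i \<in> {1..n}. r i = j}"

definition fibres :: "nat \<Rightarrow> (nat \<Rightarrow> nat) \<Rightarrow> nat set set" where
  "fibres n r = fibre n r ` r ` {1..n}"

lemma retractionD:
  assumes "r \<in> retractions n \<epsilon>" "i \<in> {1..n}"
  shows "r i \<in> {1..n}" "r i \<le> i" "r (r i) = r i" "r i \<noteq> i \<Longrightarrow> \<epsilon> i = 1" "r i \<noteq> i \<Longrightarrow> \<epsilon> (r i) = 1"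
  using assms by (auto simp: retractions_def)

lemma retraction_eps:
  assumes "r \<in> retractions n \<epsilon>" "i \<in> {1..n}"
  shows "\<epsilon> i = \<epsilon> (r i)"
  using retractionD[OF assms] by (cases "r i = i") auto

lemma inj_on_fibre: "inj_on (fibre n r) (r ` {1..n})"
proof (rule inj_onI)
  fix j j' assume j: "j \<in> r ` {1..n}" and eq: "fibre n r j = fibre n r j'"
  then obtain i where "i \<in> fibre n r j" "r i = j"
    by (auto simp: fibre_def)
  then show "j = j'"
    unfolding eq by (simp add: fibre_def)
qed

lemma fibres_in_eps_partitions:
  assumes r: "r \<in> retractions n \<epsilon>"
  shows "fibres n r \<in> eps_partitions n \<epsilon>"
proof -
  have "partition_on {1..n} (fibres n r)"
    by (rule partition_onI) (auto simp: fibres_def fibre_def disjnt_def)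
  moreover have "\<epsilon> i = 1" if p: "p \<in> fibres n r" "card p > 1" "i \<in> p" for p i
  proof -
    have p_eq: "p = fibre n r (r i)" "i \<in> {1..n}"
      using p by (auto simp: fibres_def fibre_def)
    have "p \<noteq> {r i}"
      using p(2) by auto
    moreover have "r i \<in> p"
      using p_eq retractionD(1,3)[OF r p_eq(2)] by (simp add: fibre_def)
    ultimately obtain i' where "i' \<in> p" "i' \<noteq> r i"
      by blast
    then have "i' \<in> {1..n}" "r i' = r i" "r i' \<noteq> i'"
      using p_eq by (auto simp: fibre_def)
    then have "\<epsilon> (r i) = 1"
      using retractionD(5)[OF r, of i'] by simp
    then show ?thesis
      using retraction_eps[OF r p_eq(2)] by simp
  qed
  ultimately show ?thesis
    by (auto simp: eps_partitions_def)
qed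

lemma Min_fibre:
  assumes r: "r \<in> retractions n \<epsilon>" and i: "i \<in> {1..n}"
  shows "Min (fibre n r (r i)) = r i"
proof (rule Min_eqI)
  show "r i \<le> k" if "k \<in> fibre n r (r i)" for k
    using that retractionD(2)[OF r, of k] by (simp add: fibre_def)
qed (use retractionD(1,3)[OF r i] in \<open>auto simp: fibre_def\<close>)

text \<open>The fibres of a retraction form a partition from which the retraction is recovered by taking
  minima. In a block with at least two elements some point is moved, so \<open>\<epsilon>\<close> equals one at the least
  element and at all moved points; this is the condition defining the admissible partitions.\<close>

lemma bij_betw_fibres: "bij_betw (fibres n) (retractions n \<epsilon>) (eps_partitions n \<epsilon>)"
proof (rule bij_betw_imageI)
  show "inj_on (fibres n) (retractions n \<epsilon>)"
  proof (rule inj_onI, rule ext)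
    fix r r' i assume r: "r \<in> retractions n \<epsilon>" and r': "r' \<in> retractions n \<epsilon>" and eq: "fibres n r = fibres n r'"
    show "r i = r' i"
    proof (cases "i \<in> {1..n}")
      case True
      then have "fibre n r (r i) \<in> fibres n r'"
        unfolding eq[symmetric] by (simp add: fibres_def)
      then obtain j where "fibre n r (r i) = fibre n r' j"
        unfolding fibres_def by blast
      moreover have "i \<in> fibre n r (r i)"
        using True by (simp add: fibre_def)
      ultimately have "fibre n r (r i) = fibre n r' (r' i)"
        by (simp add: fibre_def)
      then show ?thesis
        using Min_fibre[OF r True] Min_fibre[OF r' True] by simp
    next
      case False
      then show ?thesis
        using r r' by (auto simp: retractions_def PiE_def extensional_def)
    qed
  qed
  show "fibres n ` retractions n \<epsilon> = eps_partitions n \<epsilon>"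
  proof (intro equalityI subsetI)
    fix Q assume Q: "Q \<in> eps_partitions n \<epsilon>"
    then have part: "partition_on {1..n} Q"
      by (simp add: eps_partitions_def)
    define blk where "blk i = (THE p. p \<in> Q \<and> i \<in> p)" for i
    have blk_eq: "blk i = p" if "p \<in> Q" "i \<in> p" for i p
      unfolding blk_def
    proof (rule the_equality)
      show "q = p" if "q \<in> Q \<and> i \<in> q" for q
        using that \<open>p \<in> Q\<close> \<open>i \<in> p\<close> partition_onD2[OF part] by (metis disjointD IntI emptyE)
    qed (use that in simp)
    have blk: "blk i \<in> Q" "i \<in> blk i" if i: "i \<in> {1..n}" for i
    proof -
      obtain p where "p \<in> Q" "i \<in> p"
        using i partition_onD1[OF part] by blast
      then show "blk i \<in> Q" "i \<in> blk i"
        using blk_eq by auto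
    qed
    have sub: "p \<subseteq> {1..n}" if "p \<in> Q" for p
      using that partition_onD1[OF part] by blast
    then have fin: "finite p" if "p \<in> Q" for p
      using that finite_subset by blast
    define r where "r = (\<lambda>i\<in>{1..n}. Min (blk i))"
    have r_blk: "r i \<in> blk i" "r i \<le> i" "r i \<in> {1..n}" "blk (r i) = blk i" if i: "i \<in> {1..n}" for i
    proof -
      have "finite (blk i)" "blk i \<noteq> {}"
        using fin blk[OF i] by auto
      then show *: "r i \<in> blk i" "r i \<le> i"
        using i blk(2)[OF i] by (auto simp: r_def)
      then show "r i \<in> {1..n}" "blk (r i) = blk i"
        using sub blk_eq blk(1)[OF i] by blast+
    qed
    have r: "r \<in> retractions n \<epsilon>"
    proof -
      have "r (r i) = r i" if "i \<in> {1..n}" for i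
        using that r_blk(3,4)[OF that] by (simp add: r_def)
      moreover have "\<epsilon> i = 1 \<and> \<epsilon> (r i) = 1" if i: "i \<in> {1..n}" "r i \<noteq> i" for i
      proof -
        have "card {i, r i} \<le> card (blk i)"
          using blk[OF i(1)] fin r_blk(1)[OF i(1)] by (intro card_mono) auto
        then have "card (blk i) > 1"
          using i(2) by simp
        then show ?thesis
          using Q blk[OF i(1)] r_blk(1)[OF i(1)] by (auto simp: eps_partitions_def)
      qed
      moreover have "r \<in> {1..n} \<rightarrow>\<^sub>E {1..n}"
        using r_blk(3) by (auto simp: r_def)
      ultimately show ?thesis
        using r_blk(2) by (auto simp: retractions_def)
    qed
    have fibre_eq: "fibre n r (r i) = blk i" if i: "i \<in> {1..n}" for i
    proof (intro equalityI subsetI)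
      fix k assume "k \<in> fibre n r (r i)"
      then have k: "k \<in> {1..n}" "r k = r i"
        by (auto simp: fibre_def)
      then have "blk k = blk i"
        using r_blk(4)[OF k(1)] r_blk(4)[OF i] by simp
      then show "k \<in> blk i"
        using blk(2)[OF k(1)] by simp
    next
      fix k assume k: "k \<in> blk i"
      then have "k \<in> {1..n}" "blk k = blk i"
        using sub blk_eq blk(1)[OF i] by blast+
      then show "k \<in> fibre n r (r i)"
        using i by (simp add: fibre_def r_def)
    qed
    have "fibres n r = blk ` {1..n}"
      unfolding fibres_def image_image using fibre_eq by (intro image_cong) auto
    also have "\<dots> = Q"
    proof (intro equalityI subsetI)
      fix p assume p: "p \<in> Q"
      then obtain i where "i \<in> p"
        using partition_onD3[OF part] by (metis ex_in_conv)
      then show "p \<in> blk ` {1..n}"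
        using p sub blk_eq by blast
    qed (use blk in auto)
    finally show "Q \<in> fibres n ` retractions n \<epsilon>"
      using r by blast
  qed (use fibres_in_eps_partitions in blast)
qed

text \<open>Finiteness of the index set allows a merely sigma-finite factor, since then the product measure
  is determined by finite products.\<close>

lemma (in sigma_finite_measure) distr_PiM_reindex_bij:
  assumes h: "bij_betw h K I" and K: "finite K"
  shows "distr (PiM I (\<lambda>_. M)) (PiM K (\<lambda>_. M)) (\<lambda>y. \<lambda>a\<in>K. y (h a)) = PiM K (\<lambda>_. M)"
proof -
  interpret product: product_sigma_finite "\<lambda>_. M" ..
  have I: "finite I"
    using bij_betw_finite[OF h] K by simp
  have hI: "h a \<in> I" if "a \<in> K" for a
    using h that by (rule bij_betwE[rule_format])
  have meas: "(\<lambda>y. \<lambda>a\<in>K. y (h a)) \<in> measurable (PiM I (\<lambda>_. M)) (PiM K (\<lambda>_. M))"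
    by (intro measurable_restrict measurable_component_singleton hI)
  show ?thesis
  proof (rule product.PiM_eqI)
    fix A assume A: "\<And>a. a \<in> K \<Longrightarrow> A a \<in> sets M"
    let ?g = "inv_into K h"
    have g: "?g j \<in> K" "h (?g j) = j" if "j \<in> I" for j
      using that h by (auto simp: bij_betw_def inv_into_into f_inv_into_f)
    have gh: "?g (h a) = a" if "a \<in> K" for a
      using that h by (simp add: bij_betw_inv_into_left)
    have "(\<lambda>y. \<lambda>a\<in>K. y (h a)) -` (PiE K A) \<inter> space (PiM I (\<lambda>_. M)) = PiE I (\<lambda>j. A (?g j))"
    proof (intro equalityI subsetI)
      fix y assume "y \<in> (\<lambda>y. \<lambda>a\<in>K. y (h a)) -` (PiE K A) \<inter> space (PiM I (\<lambda>_. M))"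
      then have y: "(\<lambda>a\<in>K. y (h a)) \<in> PiE K A" "y \<in> extensional I"
        by (auto simp: space_PiM PiE_def)
      have "y j \<in> A (?g j)" if "j \<in> I" for j
        using PiE_mem[OF y(1) g(1)[OF that]] g[OF that] by simp
      then show "y \<in> PiE I (\<lambda>j. A (?g j))"
        using y(2) by (simp add: PiE_def)
    next
      fix y assume y: "y \<in> PiE I (\<lambda>j. A (?g j))"
      have "y (h a) \<in> A a" if "a \<in> K" for a
        using y hI[OF that] gh[OF that] by (auto simp: PiE_def Pi_iff)
      moreover have "y j \<in> space M" if "j \<in> I" for j
        using y that A[OF g(1)[OF that]] sets.sets_into_space by (auto simp: PiE_def Pi_iff)
      ultimately show "y \<in> (\<lambda>y. \<lambda>a\<in>K. y (h a)) -` (PiE K A) \<inter> space (PiM I (\<lambda>_. M))"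
        using y by (auto simp: space_PiM PiE_def)
    qed
    then have "emeasure (distr (PiM I (\<lambda>_. M)) (PiM K (\<lambda>_. M)) (\<lambda>y. \<lambda>a\<in>K. y (h a))) (PiE K A) =
        emeasure (PiM I (\<lambda>_. M)) (PiE I (\<lambda>j. A (?g j)))"
      using A K by (subst emeasure_distr[OF meas]) (auto intro!: sets_PiM_I_finite)
    also have "\<dots> = (\<Prod>j\<in>I. emeasure M (A (?g j)))"
      using A g I by (intro product.emeasure_PiM) auto
    also have "\<dots> = (\<Prod>a\<in>K. emeasure M (A (?g (h a))))"
      by (rule prod.reindex_bij_betw[OF h, symmetric])
    also have "\<dots> = (\<Prod>a\<in>K. emeasure M (A a))"
      by (intro prod.cong) (simp_all add: gh)
    finally show "emeasure (distr (PiM I (\<lambda>_. M)) (PiM K (\<lambda>_. M)) (\<lambda>y. \<lambda>a\<in>K. y (h a))) (PiE K A) =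
        (\<Prod>a\<in>K. emeasure M (A a))" .
  qed (use K in auto)
qed

context diffuse_poisson
begin

text \<open>An enumeration of the blocks renames the integration variables, and restricting the integral to
  tuples with distinct entries removes a null set.\<close>

lemma retraction_moment_eq_enumerated:
  fixes F :: "(nat \<Rightarrow> 'a) \<Rightarrow> 'a set \<Rightarrow> ennreal"
  assumes F: "(\<lambda>(x, \<omega>). F x \<omega>) \<in> borel_measurable (PiM {1..n} (\<lambda>_. borel) \<Otimes>\<^sub>M config_space)"
    and r: "r \<in> retractions n \<epsilon>" and B: "bij_betw B {1..k} (fibres n r)"
  shows "retraction_moment n \<epsilon> r F =
    (\<integral>\<^sup>+y\<in>distinct_tuples k. (\<integral>\<^sup>+\<omega>. F (spread n k B y) (\<omega> \<union> added_points k B \<epsilon> y) \<partial>P) \<partial>PiM {1..k} (\<lambda>_. \<sigma>))"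
proof -
  define I where "I = r ` {1..n}"
  \<comment> \<open>\<open>h\<close> sends the number of a block to the least element of the block, and \<open>c\<close> below sends a point
    to the number of its block.\<close>
  define h where "h a = the_inv_into I (fibre n r) (B a)" for a
  have fibre_bij: "bij_betw (fibre n r) I (fibres n r)"
    unfolding I_def fibres_def using inj_on_fibre by (rule inj_on_imp_bij_betw)
  have h: "bij_betw h {1..k} I"
    unfolding h_def[abs_def]
    using bij_betw_trans[OF B bij_betw_the_inv_into[OF fibre_bij]] by (simp add: comp_def)
  have B_eq: "B a = fibre n r (h a)" if "a \<in> {1..k}" for a
    unfolding h_def using f_the_inv_into_f_bij_betw[OF fibre_bij, of "B a"] bij_betwE[OF B] that by simp
  have hI: "h a \<in> I" if "a \<in> {1..k}" for a
    using bij_betwE[OF h] that by blast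
  define c where "c i = (THE a. a \<in> {1..k} \<and> i \<in> B a)" for i
  have c: "c i \<in> {1..k}" "h (c i) = r i" if i: "i \<in> {1..n}" for i
  proof -
    have "r i \<in> I"
      using i by (simp add: I_def)
    then obtain a where a: "a \<in> {1..k}" "h a = r i"
      using h by (metis bij_betw_iff_bijections)
    have "c i = a"
      unfolding c_def
    proof (rule the_equality)
      show "a \<in> {1..k} \<and> i \<in> B a"
        using a i by (simp add: B_eq fibre_def)
      show "a' = a" if a': "a' \<in> {1..k} \<and> i \<in> B a'" for a'
      proof -
        have "i \<in> fibre n r (h a')"
          using a' B_eq by blast
        then have "h a' = h a"
          using a by (simp add: fibre_def)
        then show ?thesis
          using inj_onD[OF bij_betw_imp_inj_on[OF h]] a' a(1) by blast
      qed
    qed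
    then show "c i \<in> {1..k}" "h (c i) = r i"
      using a by auto
  qed
  have eps: "block_eps B \<epsilon> a = \<epsilon> (h a)" if a: "a \<in> {1..k}" for a
  proof -
    obtain i where i: "i \<in> {1..n}" "h a = r i"
      using hI[OF a] by (auto simp: I_def)
    then have "i \<in> B a"
      using a by (simp add: B_eq fibre_def)
    then have "(SOME j. j \<in> B a) \<in> B a"
      by (rule someI)
    then have "(SOME j. j \<in> B a) \<in> {1..n}" "r (SOME j. j \<in> B a) = h a"
      using a by (auto simp: B_eq fibre_def)
    then show ?thesis
      unfolding block_eps_def using retraction_eps[OF r] by metis
  qed
  have spread: "spread n k B = block_point c n"
    by (simp add: spread_def[abs_def] block_point_def[abs_def] c_def)
  have added: "added_points k B \<epsilon> y = y ` {a \<in> {1..k}. \<epsilon> (h a) = 1}" for y :: "nat \<Rightarrow> 'a"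
    using eps by (auto simp: added_points_def)
  define g where "g y = (\<integral>\<^sup>+\<omega>. F (spread n k B y) (\<omega> \<union> added_points k B \<epsilon> y) \<partial>P)" for y
  have g: "g \<in> borel_measurable (PiM {1..k} (\<lambda>_. \<sigma>))"
  proof -
    let ?N = "PiM {1..k} (\<lambda>_. \<sigma>) \<Otimes>\<^sub>M P"
    have comp: "(\<lambda>w. fst w a) \<in> measurable ?N borel" if "a \<in> {1..k}" for a
      by (rule measurable_compose[OF measurable_fst measurable_PiM_\<sigma>_component[OF that]])
    have "block_point c n \<in> measurable (PiM {1..k} (\<lambda>_. \<sigma>)) (PiM {1..n} (\<lambda>_. borel))"
      by (rule measurable_block_point) (use c in auto)
    then have "(\<lambda>w. block_point c n (fst w)) \<in> measurable ?N (PiM {1..n} (\<lambda>_. borel))"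
      by (rule measurable_compose[OF measurable_fst])
    moreover have "(\<lambda>w. snd w \<union> fst w ` {a \<in> {1..k}. \<epsilon> (h a) = 1}) \<in> measurable ?N config_space"
    proof (rule measurable_union_config)
      show "snd \<in> measurable ?N config_space"
        by measurable
    qed (auto intro: comp)
    ultimately have "(\<lambda>w. F (block_point c n (fst w)) (snd w \<union> fst w ` {a \<in> {1..k}. \<epsilon> (h a) = 1})) \<in> borel_measurable ?N"
      using measurable_compose[OF measurable_Pair F] by simp
    then show ?thesis
      unfolding g_def[abs_def] spread added by (intro borel_measurable_nn_integral) (simp add: case_prod_beta')
  qed
  have "(\<integral>\<^sup>+y\<in>distinct_tuples k. g y \<partial>PiM {1..k} (\<lambda>_. \<sigma>)) = (\<integral>\<^sup>+y. g y \<partial>PiM {1..k} (\<lambda>_. \<sigma>))"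
  proof (rule nn_integral_cong_AE)
    have "finite {1..k}"
      by simp
    from AE_PiM_inj_on[OF this] AE_space
    show "AE y in PiM {1..k} (\<lambda>_. \<sigma>). g y * indicator (distinct_tuples k) y = g y"
      by eventually_elim (auto simp: distinct_tuples_def space_PiM space_\<sigma> indicator_def)
  qed
  also have "\<dots> = (\<integral>\<^sup>+y. g y \<partial>distr (PiM I (\<lambda>_. \<sigma>)) (PiM {1..k} (\<lambda>_. \<sigma>)) (\<lambda>y. \<lambda>a\<in>{1..k}. y (h a)))"
    using sigma.distr_PiM_reindex_bij[OF h] by simp
  also have "\<dots> = (\<integral>\<^sup>+y. g (\<lambda>a\<in>{1..k}. y (h a)) \<partial>PiM I (\<lambda>_. \<sigma>))"
    using g by (intro nn_integral_distr measurable_restrict measurable_component_singleton hI) auto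
  also have "\<dots> = retraction_moment n \<epsilon> r F"
    unfolding retraction_moment_def g_def I_def[symmetric]
  proof (intro nn_integral_cong arg_cong2[where f=F] arg_cong2[where f="(\<union>)"] refl)
    fix y :: "nat \<Rightarrow> 'a"
    show "spread n k B (\<lambda>a\<in>{1..k}. y (h a)) = block_point r n y"
      unfolding spread using c by (auto simp: block_point_def fun_eq_iff)
    have "h ` {a \<in> {1..k}. \<epsilon> (h a) = 1} = {j \<in> I. \<epsilon> j = 1}"
      using h by (auto simp: bij_betw_def)
    then show "added_points k B \<epsilon> (\<lambda>a\<in>{1..k}. y (h a)) = y ` {j \<in> I. \<epsilon> j = 1}"
      unfolding added by (auto simp flip: image_image)
  qed
  finally show ?thesis
    by (simp add: g_def)
qed

end

section \<open>The moment formula indexed by partitions\<close>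

theorem theorem2p4:
  fixes \<sigma> :: "'a::{metric_space, second_countable_topology} measure"
    and P :: "'a set measure"
    and n :: nat
    and f :: "(nat \<Rightarrow> 'a) \<Rightarrow> 'a set \<Rightarrow> ereal"
    and \<epsilon> :: "nat \<Rightarrow> nat"
    and blocks :: "nat set set \<Rightarrow> nat \<Rightarrow> nat set"
  assumes "locally_compact_space (euclidean :: 'a topology)"
    and "sets \<sigma> = sets borel"
    and "\<And>K. compact K \<Longrightarrow> emeasure \<sigma> K < \<infinity>"
    and "non_atomic \<sigma>"
    and "poisson_random_measure \<sigma> P"
    and "n \<ge> 1"
    and "n_process n f"
    and "\<And>x \<omega>. x \<in> {1..n} \<rightarrow>\<^sub>E UNIV \<Longrightarrow> \<omega> \<in> configurations \<Longrightarrow> f x \<omega> \<ge> 0"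
    and "\<epsilon> \<in> {1..n} \<rightarrow> {0, 1}"
    and "\<And>Q. Q \<in> eps_partitions n \<epsilon> \<Longrightarrow> bij_betw (blocks Q) {1..card Q} Q"
  shows "(\<integral>\<^sup>+\<omega>. (\<integral>\<^sup>+x. e2ennreal (f x \<omega>) \<partial>(PiM {1..n} (\<lambda>i. choose_measure \<sigma> \<omega> (\<epsilon> i)))) \<partial>P) =
    (\<Sum>Q\<in>eps_partitions n \<epsilon>.
       (\<integral>\<^sup>+y\<in>distinct_tuples (card Q).
          (\<integral>\<^sup>+\<omega>. e2ennreal (f (spread n (card Q) (blocks Q) y)
                                  (\<omega> \<union> added_points (card Q) (blocks Q) \<epsilon> y)) \<partial>P)
        \<partial>(PiM {1..card Q} (\<lambda>_. \<sigma>))))"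
proof -
  obtain D :: "nat \<Rightarrow> 'a set" where D: "\<And>m. D m \<in> sets borel" "disjoint_family D" "(\<Union>m. D m) = UNIV"
    "\<And>m. emeasure \<sigma> (D m) < \<infinity>" "\<And>m \<omega>. \<omega> \<in> configurations \<Longrightarrow> finite (\<omega> \<inter> D m)"
    using bounded_borel_partition[OF assms(1,2,3)] by metis
  have point: "emeasure \<sigma> {x} = 0" for x
  proof (rule ccontr)
    \<comment> \<open>A charged point would be an atom, as its only subsets are itself and the empty set.\<close>
    assume "emeasure \<sigma> {x} \<noteq> 0"
    moreover have "B = {} \<or> B = {x}" if "B \<subseteq> {x}" for B
      using that by blast
    ultimately have "atom_of \<sigma> {x}"
      unfolding atom_of_def by (auto simp: assms(2) zero_less_iff_neq_zero)
    then show False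
      using assms(4) by (auto simp: non_atomic_def)
  qed
  interpret prob_space P
    using assms(5) by (simp add: poisson_random_measure_def)
  interpret diffuse_poisson D P \<sigma>
    by unfold_locales (use D assms(2,5) point in auto)
  define F where "F x \<omega> = e2ennreal (f x \<omega>)" for x \<omega>
  have F: "(\<lambda>(x, \<omega>). F x \<omega>) \<in> borel_measurable (PiM {1..n} (\<lambda>_. borel) \<Otimes>\<^sub>M config_space)"
    using assms(7) unfolding n_process_def F_def case_prod_beta' by measurable
  have "(\<integral>\<^sup>+\<omega>. (\<integral>\<^sup>+x. F x \<omega> \<partial>(PiM {1..n} (\<lambda>i. choose_measure \<sigma> \<omega> (\<epsilon> i)))) \<partial>P) =
      (\<Sum>r\<in>retractions n \<epsilon>. retraction_moment n \<epsilon> r F)"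
    by (rule moment_formula_retractions[OF F])
  also have "\<dots> = (\<Sum>r\<in>retractions n \<epsilon>. (\<lambda>Q. \<integral>\<^sup>+y\<in>distinct_tuples (card Q).
      (\<integral>\<^sup>+\<omega>. F (spread n (card Q) (blocks Q) y) (\<omega> \<union> added_points (card Q) (blocks Q) \<epsilon> y) \<partial>P)
        \<partial>(PiM {1..card Q} (\<lambda>_. \<sigma>))) (fibres n r))"
    using retraction_moment_eq_enumerated[OF F _ assms(10)[OF fibres_in_eps_partitions]]
    by (intro sum.cong refl) blast
  also have "\<dots> = (\<Sum>Q\<in>eps_partitions n \<epsilon>. \<integral>\<^sup>+y\<in>distinct_tuples (card Q).
      (\<integral>\<^sup>+\<omega>. F (spread n (card Q) (blocks Q) y) (\<omega> \<union> added_points (card Q) (blocks Q) \<epsilon> y) \<partial>P)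
        \<partial>(PiM {1..card Q} (\<lambda>_. \<sigma>)))"
    by (rule sum.reindex_bij_betw[OF bij_betw_fibres])
  finally show ?thesis
    by (simp add: F_def)
qed

end
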